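(* The set $\Xi$ of all inconsistency pairs is transitive and normal.
   Context: $T$ is a complete consistent first-order theory (possibly many-sorted); we work in a big saturated model of $T$. All sets are small subsets of the big model; $BC$ means $B\cup C$. A tuple also denotes the set of its entries, and $\bar a\in A$ means that all entries of $\bar a$ lie in $A$. Inconsistency pairs: for a formula $\varphi(\bar x;\bar y)$ whose free variables are partitioned into two blocks, a parameter-free formula $\psi(\bar y_0,\dots,\bar y_{k-1})$ (also written $\psi(\bar y_{<k})$) is a $k$-inconsistency witness for $\varphi(\bar x;\bar y)$ if $\big(\bigwedge_{i<k}\varphi(\bar x;\bar y_i)\big)\wedge\psi(\bar y_{<k})$ is inconsistent. $\Xi$ is the set of all pairs $(\varphi(\bar x;\bar y),\psi(\bar y_{<k}))$, $k<\omega$, such that $\psi$ is a $k$-inconsistency witness for $\varphi$. For $(\varphi,\psi)\in\Xi$, a formula $\varphi(\bar x;\bar b)$ $(\varphi,\psi)$-divides over $C$ if there is a sequence $(\bar b_i)_{i<\omega}$ such that each $\bar b_i$ realises $\operatorname{tp}(\bar b/C)$ and $\models\psi(\bar b_{i_0},\dots,\bar b_{i_{k-1}})$ for all $i_0<\dots<i_{k-1}<\omega$. For $\Omega\subseteq\Xi$, a partial type $\Omega$-divides over $C$ if for some $(\varphi,\psi)\in\Omega$ it contains a formula $\varphi(\bar x;\bar b)$ that $(\varphi,\psi)$-divides over $C$. Define $A\perp^{\Omega}_CB$ iff there is no $\bar a\in A$ such that $\operatorname{tp}(\bar a/BC)$ $\Omega$-divides over $C$. - $\Omega$ is transitive if: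 whenever $(\varphi(\bar y;\bar x),\psi(\bar x_{<k}))\in\Omega$, $D\subseteq C$, $C\perp^\Omega_D\bar a$ and $\varphi(\bar y;\bar a)$ $(\varphi,\psi)$-divides over $D$, then $\varphi(\bar y;\bar a)$ $(\varphi,\psi)$-divides over $C$. - $\Omega$ is normal if: whenever $(\varphi(\bar x,\bar z;\bar y),\psi(\bar y_{<k}))\in\Omega$, then also $(\varphi(\bar x;\bar z,\bar y),\psi'(\bar y_{<k},\bar z_{<k}))\in\Omega$, where $\psi'(\bar y_{<k},\bar z_{<k})$ is $\psi(\bar y_{<k})\wedge(\bar z_0=\bar z_1=\dots=\bar z_{k-1})$. *)

theory Defs
  imports Main
begin

unbundle cardinal_syntax

section \<open>Many-sorted first-order logic\<close>

text \<open>
  The sorts are the elements of the type \<open>'s\<close>. The symbols of a language are those on which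
  \<open>fun_rank\<close> (argument sorts and value sort) resp. \<open>rel_rank\<close> (argument sorts) is not \<open>None\<close>,
  so a language may lack function symbols or relation symbols altogether.
\<close>

record ('s, 'f, 'r) lang =
  fun_rank :: "'f \<Rightarrow> ('s list \<times> 's) option"
  rel_rank :: "'r \<Rightarrow> 's list option"

type_synonym 's var = "'s \<times> nat"

datatype ('s, 'f) tm = Var "'s var" | Fun 'f "('s, 'f) tm list"

datatype ('s, 'f, 'r) fm =
    Fls
  | Eq "('s, 'f) tm" "('s, 'f) tm"
  | Rel 'r "('s, 'f) tm list"
  | Neg "('s, 'f, 'r) fm"
  | And "('s, 'f, 'r) fm" "('s, 'f, 'r) fm"
  | Ex "'s var" "('s, 'f, 'r) fm"

definition Tru :: "('s, 'f, 'r) fm" where "Tru = Neg Fls"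

inductive has_sort :: "('s, 'f, 'r) lang \<Rightarrow> ('s, 'f) tm \<Rightarrow> 's \<Rightarrow> bool" for L where
  "has_sort L (Var v) (fst v)"
| "\<lbrakk>fun_rank L f = Some (ss, s); list_all2 (has_sort L) ts ss\<rbrakk> \<Longrightarrow> has_sort L (Fun f ts) s"

primrec wf_fm :: "('s, 'f, 'r) lang \<Rightarrow> ('s, 'f, 'r) fm \<Rightarrow> bool" where
  "wf_fm L Fls \<longleftrightarrow> True"
| "wf_fm L (Eq t u) \<longleftrightarrow> (\<exists>s. has_sort L t s \<and> has_sort L u s)"
| "wf_fm L (Rel r ts) \<longleftrightarrow> (\<exists>ss. rel_rank L r = Some ss \<and> list_all2 (has_sort L) ts ss)"
| "wf_fm L (Neg \<phi>) \<longleftrightarrow> wf_fm L \<phi>"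
| "wf_fm L (And \<phi> \<chi>) \<longleftrightarrow> wf_fm L \<phi> \<and> wf_fm L \<chi>"
| "wf_fm L (Ex v \<phi>) \<longleftrightarrow> wf_fm L \<phi>"

primrec fv_tm :: "('s, 'f) tm \<Rightarrow> 's var set" where
  "fv_tm (Var v) = {v}"
| "fv_tm (Fun f ts) = \<Union> (set (map fv_tm ts))"

primrec fv :: "('s, 'f, 'r) fm \<Rightarrow> 's var set" where
  "fv Fls = {}"
| "fv (Eq t u) = fv_tm t \<union> fv_tm u"
| "fv (Rel r ts) = \<Union> (set (map fv_tm ts))"
| "fv (Neg \<phi>) = fv \<phi>"
| "fv (And \<phi> \<chi>) = fv \<phi> \<union> fv \<chi>"
| "fv (Ex v \<phi>) = fv \<phi> - {v}"

definition sentence :: "('s, 'f, 'r) lang \<Rightarrow> ('s, 'f, 'r) fm \<Rightarrow> bool" where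
  "sentence L \<sigma> \<longleftrightarrow> wf_fm L \<sigma> \<and> fv \<sigma> = {}"

record ('s, 'f, 'r, 'u) struc =
  dom :: "'s \<Rightarrow> 'u set"
  fun_int :: "'f \<Rightarrow> 'u list \<Rightarrow> 'u"
  rel_int :: "'r \<Rightarrow> 'u list \<Rightarrow> bool"

definition univ :: "('s, 'f, 'r, 'u) struc \<Rightarrow> 'u set" where
  "univ M = (\<Union>s. dom M s)"

definition is_struc :: "('s, 'f, 'r) lang \<Rightarrow> ('s, 'f, 'r, 'u) struc \<Rightarrow> bool" where
  "is_struc L M \<longleftrightarrow>
     (\<forall>s. dom M s \<noteq> {}) \<and>
     (\<forall>s s'. s \<noteq> s' \<longrightarrow> dom M s \<inter> dom M s' = {}) \<and>
     (\<forall>f ss s as. fun_rank L f = Some (ss, s) \<and> list_all2 (\<lambda>a s. a \<in> dom M s) as ss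
        \<longrightarrow> fun_int M f as \<in> dom M s)"

primrec val :: "('s, 'f, 'r, 'u) struc \<Rightarrow> ('s var \<Rightarrow> 'u) \<Rightarrow> ('s, 'f) tm \<Rightarrow> 'u" where
  "val M e (Var v) = e v"
| "val M e (Fun f ts) = fun_int M f (map (val M e) ts)"

primrec sat :: "('s, 'f, 'r, 'u) struc \<Rightarrow> ('s var \<Rightarrow> 'u) \<Rightarrow> ('s, 'f, 'r) fm \<Rightarrow> bool" where
  "sat M e Fls \<longleftrightarrow> False"
| "sat M e (Eq t u) \<longleftrightarrow> val M e t = val M e u"
| "sat M e (Rel r ts) \<longleftrightarrow> rel_int M r (map (val M e) ts)"
| "sat M e (Neg \<phi>) \<longleftrightarrow> \<not> sat M e \<phi>"
| "sat M e (And \<phi> \<chi>) \<longleftrightarrow> sat M e \<phi> \<and> sat M e \<chi>"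
| "sat M e (Ex v \<phi>) \<longleftrightarrow> (\<exists>a \<in> dom M (fst v). sat M (e(v := a)) \<phi>)"

definition assignment :: "('s, 'f, 'r, 'u) struc \<Rightarrow> ('s var \<Rightarrow> 'u) \<Rightarrow> bool" where
  "assignment M e \<longleftrightarrow> (\<forall>v. e v \<in> dom M (fst v))"

text \<open>
  \<open>holds M \<phi> [xs, ys, \<dots>] [a, b, \<dots>]\<close> says that \<open>\<phi>(a; b; \<dots>)\<close> is true in \<open>M\<close>, where the tuples
  \<open>a, b, \<dots>\<close> are substituted for the blocks of variables \<open>xs, ys, \<dots>\<close>. It is false if lengths or
  sorts do not match. When the variables are distinct and include all free variables of \<open>\<phi>\<close>, the
  choice of the assignment does not matter.
\<close>

definition holds ::
  "('s, 'f, 'r, 'u) struc \<Rightarrow> ('s, 'f, 'r) fm \<Rightarrow> 's var list list \<Rightarrow> 'u list list \<Rightarrow> bool" where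
  "holds M \<phi> vss as \<longleftrightarrow> (\<exists>e. assignment M e \<and> map (map e) vss = as \<and> sat M e \<phi>)"

definition models :: "('s, 'f, 'r, 'u) struc \<Rightarrow> ('s, 'f, 'r) fm set \<Rightarrow> bool" where
  "models M T \<longleftrightarrow> (\<forall>\<sigma>\<in>T. holds M \<sigma> [] [])"


section \<open>Complete theories and the big model\<close>

text \<open>
  The models quantified over in the next two definitions have universes contained in the type of
  formulas. This type is infinite and has at least as many elements as there are sorts and symbols,
  so by the downward Loewenheim-Skolem theorem the restriction is harmless.
\<close>

definition consistent :: "('s, 'f, 'r) lang \<Rightarrow> ('s, 'f, 'r) fm set \<Rightarrow> bool" where
  "consistent L T \<longleftrightarrow>
     (\<exists>N :: ('s, 'f, 'r, ('s, 'f, 'r) fm) struc. is_struc L N \<and> models N T)"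

definition entails ::
  "('s, 'f, 'r) lang \<Rightarrow> ('s, 'f, 'r) fm set \<Rightarrow> ('s, 'f, 'r) fm \<Rightarrow> bool" where
  "entails L T \<sigma> \<longleftrightarrow>
     (\<forall>N :: ('s, 'f, 'r, ('s, 'f, 'r) fm) struc. is_struc L N \<and> models N T \<longrightarrow> holds N \<sigma> [] [])"

definition complete :: "('s, 'f, 'r) lang \<Rightarrow> ('s, 'f, 'r) fm set \<Rightarrow> bool" where
  "complete L T \<longleftrightarrow> (\<forall>\<sigma>. sentence L \<sigma> \<longrightarrow> entails L T \<sigma> \<or> entails L T (Neg \<sigma>))"

text \<open>
  A formula \<open>\<phi>(x; y)\<close> with its free variables split into two blocks. As usual, a variable of the
  tuples \<open>x\<close>, \<open>y\<close> need not actually occur in \<open>\<phi>\<close>.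
\<close>

type_synonym ('s, 'f, 'r) pfm = "('s, 'f, 'r) fm \<times> 's var list \<times> 's var list"

fun is_pfm :: "('s, 'f, 'r) lang \<Rightarrow> ('s, 'f, 'r) pfm \<Rightarrow> bool" where
  "is_pfm L (\<phi>, xs, ys) \<longleftrightarrow> wf_fm L \<phi> \<and> distinct (xs @ ys) \<and> fv \<phi> \<subseteq> set (xs @ ys)"

text \<open>
  A formula \<open>\<phi>(x; b)\<close> with parameters is a pair \<open>((\<phi>, xs, ys), b)\<close>; a partial type is a set of
  such pairs. The names of the variables in the block \<open>xs\<close> are immaterial: only their number and
  sorts matter for being realised by a tuple.
\<close>

type_synonym ('s, 'f, 'r, 'u) inst = "('s, 'f, 'r) pfm \<times> 'u list"

definition inst_over ::
  "('s, 'f, 'r) lang \<Rightarrow> 'u set \<Rightarrow> ('s, 'f, 'r, 'u) inst set" where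
  "inst_over L A = {(p, b). is_pfm L p \<and> set b \<subseteq> A}"

definition realises ::
  "('s, 'f, 'r, 'u) struc \<Rightarrow> 'u list \<Rightarrow> ('s, 'f, 'r, 'u) inst set \<Rightarrow> bool" where
  "realises M a p \<longleftrightarrow> (\<forall>((\<phi>, xs, ys), b) \<in> p. holds M \<phi> [xs, ys] [a, b])"

definition tp ::
  "('s, 'f, 'r) lang \<Rightarrow> ('s, 'f, 'r, 'u) struc \<Rightarrow> 'u list \<Rightarrow> 'u set \<Rightarrow> ('s, 'f, 'r, 'u) inst set"
where
  "tp L M a B = {((\<phi>, xs, ys), b) \<in> inst_over L B. holds M \<phi> [xs, ys] [a, b]}"

definition small :: "('s, 'f, 'r, 'u) struc \<Rightarrow> 'k rel \<Rightarrow> 'u set \<Rightarrow> bool" where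
  "small M \<kappa> A \<longleftrightarrow> A \<subseteq> univ M \<and> |A| <o \<kappa>"

definition saturated ::
  "('s, 'f, 'r) lang \<Rightarrow> ('s, 'f, 'r, 'u) struc \<Rightarrow> 'k rel \<Rightarrow> bool" where
  "saturated L M \<kappa> \<longleftrightarrow>
     (\<forall>A p. small M \<kappa> A \<and> p \<subseteq> inst_over L A \<and>
        (\<forall>q. finite q \<and> q \<subseteq> p \<longrightarrow> (\<exists>a. realises M a q))
        \<longrightarrow> (\<exists>a. realises M a p))"

text \<open>
  The big model is \<open>\<kappa>\<close>-saturated for a cardinal \<open>\<kappa>\<close> exceeding the number of formulas, and small
  means of cardinality less than \<open>\<kappa>\<close>. For \<open>\<kappa> = |univ M|\<close> these are the models that are saturated
  in their own cardinality; keeping \<open>\<kappa>\<close> separate also admits theories with finite models.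
\<close>

definition big_model ::
  "('s, 'f, 'r) lang \<Rightarrow> ('s, 'f, 'r) fm set \<Rightarrow> ('s, 'f, 'r, 'u) struc \<Rightarrow> 'k rel \<Rightarrow> bool" where
  "big_model L T M \<kappa> \<longleftrightarrow>
     is_struc L M \<and> models M T \<and> Card_order \<kappa> \<and> |{\<phi>. wf_fm L \<phi>}| <o \<kappa> \<and> saturated L M \<kappa>"


section \<open>Inconsistency pairs and dividing\<close>

text \<open>
  \<open>(\<psi>, yss)\<close> stands for \<open>\<psi>(y\<^sub>0, \<dots>, y\<^bsub>k-1\<^esub>)\<close> with \<open>k = length yss\<close>; each block in \<open>yss\<close> is a copy
  of the block \<open>y\<close> of \<open>\<phi>(x; y)\<close>.
\<close>

type_synonym ('s, 'f, 'r) kfm = "('s, 'f, 'r) fm \<times> 's var list list"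

definition copies :: "'s var list list \<Rightarrow> 's var list \<Rightarrow> bool" where
  "copies yss ys \<longleftrightarrow> (\<forall>zs \<in> set yss. map fst zs = map fst ys)"

fun is_kfm :: "('s, 'f, 'r) lang \<Rightarrow> 's var list \<Rightarrow> ('s, 'f, 'r) kfm \<Rightarrow> bool" where
  "is_kfm L ys (\<psi>, yss) \<longleftrightarrow>
     wf_fm L \<psi> \<and> distinct (concat yss) \<and> copies yss ys \<and> fv \<psi> \<subseteq> set (concat yss)"

text \<open>
  Inconsistency is that of the big model: no tuples satisfy the conjunction. For a complete theory
  this is the same as inconsistency with the theory.
\<close>

fun inconsistency_witness ::
  "('s, 'f, 'r, 'u) struc \<Rightarrow> ('s, 'f, 'r) pfm \<Rightarrow> ('s, 'f, 'r) kfm \<Rightarrow> bool" where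
  "inconsistency_witness M (\<phi>, xs, ys) (\<psi>, yss) \<longleftrightarrow>
     \<not> (\<exists>a bs. (\<forall>b \<in> set bs. holds M \<phi> [xs, ys] [a, b]) \<and> holds M \<psi> yss bs)"

definition Xi ::
  "('s, 'f, 'r) lang \<Rightarrow> ('s, 'f, 'r, 'u) struc \<Rightarrow> (('s, 'f, 'r) pfm \<times> ('s, 'f, 'r) kfm) set"
where
  "Xi L M = {((\<phi>, xs, ys), (\<psi>, yss)).
     is_pfm L (\<phi>, xs, ys) \<and> is_kfm L ys (\<psi>, yss) \<and>
     inconsistency_witness M (\<phi>, xs, ys) (\<psi>, yss)}"

text \<open>
  \<open>divides L M (\<psi>, yss) b C\<close>: for any \<open>\<phi>\<close> with \<open>(\<phi>, \<psi>) \<in> \<Xi>\<close>, the formula \<open>\<phi>(x; b)\<close>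
  \<open>(\<phi>, \<psi>)\<close>-divides over \<open>C\<close>. The condition does not involve \<open>\<phi>\<close> itself.
\<close>

fun divides ::
  "('s, 'f, 'r) lang \<Rightarrow> ('s, 'f, 'r, 'u) struc \<Rightarrow> ('s, 'f, 'r) kfm \<Rightarrow> 'u list \<Rightarrow> 'u set \<Rightarrow> bool"
where
  "divides L M (\<psi>, yss) b C \<longleftrightarrow>
     (\<exists>bs :: nat \<Rightarrow> 'u list.
        (\<forall>i. realises M (bs i) (tp L M b C)) \<and>
        (\<forall>is. sorted_wrt (<) is \<and> length is = length yss \<longrightarrow> holds M \<psi> yss (map bs is)))"

definition type_divides ::
  "('s, 'f, 'r) lang \<Rightarrow> ('s, 'f, 'r, 'u) struc \<Rightarrow> (('s, 'f, 'r) pfm \<times> ('s, 'f, 'r) kfm) set \<Rightarrow>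
   ('s, 'f, 'r, 'u) inst set \<Rightarrow> 'u set \<Rightarrow> bool"
where
  "type_divides L M \<Omega> p C \<longleftrightarrow> (\<exists>(\<phi>, \<psi>) \<in> \<Omega>. \<exists>b. (\<phi>, b) \<in> p \<and> divides L M \<psi> b C)"

text \<open>\<open>indep L M \<Omega> A C B\<close> is \<open>A \<bottom>\<^sup>\<Omega>\<^sub>C B\<close>, with the base in the middle.\<close>

definition indep ::
  "('s, 'f, 'r) lang \<Rightarrow> ('s, 'f, 'r, 'u) struc \<Rightarrow> (('s, 'f, 'r) pfm \<times> ('s, 'f, 'r) kfm) set \<Rightarrow>
   'u set \<Rightarrow> 'u set \<Rightarrow> 'u set \<Rightarrow> bool"
where
  "indep L M \<Omega> A C B \<longleftrightarrow>
     \<not> (\<exists>a. set a \<subseteq> A \<and> type_divides L M \<Omega> (tp L M a (B \<union> C)) C)"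

definition transitive_pairs ::
  "('s, 'f, 'r) lang \<Rightarrow> ('s, 'f, 'r, 'u) struc \<Rightarrow> 'k rel \<Rightarrow>
   (('s, 'f, 'r) pfm \<times> ('s, 'f, 'r) kfm) set \<Rightarrow> bool"
where
  "transitive_pairs L M \<kappa> \<Omega> \<longleftrightarrow>
     (\<forall>\<phi> \<psi> C D a. (\<phi>, \<psi>) \<in> \<Omega> \<and> small M \<kappa> C \<and> D \<subseteq> C \<and> set a \<subseteq> univ M \<and>
        indep L M \<Omega> C D (set a) \<and> divides L M \<psi> a D \<longrightarrow> divides L M \<psi> a C)"

text \<open>The formula \<open>z\<^sub>0 = z\<^sub>1 = \<dots> = z\<^bsub>k-1\<^esub>\<close> for tuples of variables.\<close>

fun eq_tuple :: "'s var list \<Rightarrow> 's var list \<Rightarrow> ('s, 'f, 'r) fm" where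
  "eq_tuple (u # us) (v # vs) = And (Eq (Var u) (Var v)) (eq_tuple us vs)"
| "eq_tuple _ _ = Tru"

fun eq_tuples :: "'s var list list \<Rightarrow> ('s, 'f, 'r) fm" where
  "eq_tuples (us # vs # zss) = And (eq_tuple us vs) (eq_tuples (vs # zss))"
| "eq_tuples _ = Tru"

text \<open>The variables in \<open>zss\<close> are fresh copies of \<open>zs\<close>, arbitrary apart from their sorts.\<close>

definition normal_pairs ::
  "(('s, 'f, 'r) pfm \<times> ('s, 'f, 'r) kfm) set \<Rightarrow> bool"
where
  "normal_pairs \<Omega> \<longleftrightarrow>
     (\<forall>\<phi> xs zs ys \<psi> yss zss.
        ((\<phi>, xs @ zs, ys), (\<psi>, yss)) \<in> \<Omega> \<and>
        length zss = length yss \<and> copies zss zs \<and> distinct (concat (yss @ zss))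
        \<longrightarrow> ((\<phi>, xs, zs @ ys), (And \<psi> (eq_tuples zss), map2 (@) zss yss)) \<in> \<Omega>)"

end

theory Submission
  imports Defs
begin

text \<open>
  For transitivity, let \<open>\<psi>\<close> witness that \<open>a\<close> divides over \<open>D\<close>. By saturation it is enough that
  \<open>tp(a/C)(x\<^sub>i)\<close> for all \<open>i\<close> and \<open>\<psi>\<close> on all increasing subsequences of \<open>(x\<^sub>i)\<close> are finitely satisfiable.
  If they are not, finitely many of these conditions form a new pair in \<open>\<Xi>\<close>, and by that pair the type
  of a finite tuple of \<open>C\<close> over \<open>D \<union> a\<close> divides over \<open>D\<close>, contradicting \<open>C \<bottom>\<^sub>D a\<close>. No indiscernible
  sequences are needed.
\<close>

text \<open>A pair in \<Xi> is parameter-free, whereas the failure of finite satisfiability involves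
  a finite tuple c of C. So c is replaced by the object variables z of the new formula, and the
  statement that no suitable finite sequence exists for z is made a conjunct of that formula. The
  dividing sequence for the new pair is the given one: its terms already realise tp(a/D), and all
  its increasing subsequences of the right length satisfy \<psi>. Named variables make it laborious
  to write down such formulas. They are therefore built as predicates on assignments, closed under
  Boolean operations, quantifiers and renaming, and become syntax again only where \<open>Xi\<close>
  or \<open>saturated\<close> asks for it. Variables and instances are pairs; the simplifier is kept
  from splitting quantifiers over them.\<close>

declare split_paired_All [simp del] split_paired_Ex [simp del]

section \<open>Renaming variables\<close>

lemma val_cong: "(\<And>v. v \<in> fv_tm t \<Longrightarrow> e v = e' v) \<Longrightarrow> val M e t = val M e' t"
proof (induction t)
  case (Fun f ts)
  have "map (val M e) ts = map (val M e') ts"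
    using Fun by (intro map_cong refl) (auto intro!: Fun.IH)
  then show ?case by (metis val.simps(2))
qed auto

lemma sat_cong: "(\<And>v. v \<in> fv \<phi> \<Longrightarrow> e v = e' v) \<Longrightarrow> sat M e \<phi> \<longleftrightarrow> sat M e' \<phi>"
proof (induction \<phi> arbitrary: e e')
  case (Eq t u)
  have "val M e t = val M e' t" "val M e u = val M e' u"
    by (rule val_cong; simp add: Eq)+
  then show ?case by simp
next
  case (Rel r ts)
  have "map (val M e) ts = map (val M e') ts"
    using Rel by (intro map_cong refl) (auto intro!: val_cong)
  then show ?case by (metis sat.simps(3))
next
  case (Neg \<phi>)
  then show ?case by (metis fv.simps(4) sat.simps(4))
next
  case (And \<phi> \<chi>)
  then show ?case by (metis UnCI fv.simps(5) sat.simps(5))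
next
  case (Ex v \<phi>)
  have "sat M (e(v := a)) \<phi> \<longleftrightarrow> sat M (e'(v := a)) \<phi>" for a
    by (rule Ex.IH) (auto simp: Ex.prems)
  then show ?case by simp
qed auto

primrec ren_tm :: "('s var \<Rightarrow> 's var) \<Rightarrow> ('s, 'f) tm \<Rightarrow> ('s, 'f) tm" where
  "ren_tm \<pi> (Var v) = Var (\<pi> v)"
| "ren_tm \<pi> (Fun f ts) = Fun f (map (ren_tm \<pi>) ts)"

text \<open>Binders are renamed together with free variables. For injective \<open>\<pi>\<close>
  this cannot cause capture, so no fresh bound variables have to be chosen.\<close>

primrec ren_fm :: "('s var \<Rightarrow> 's var) \<Rightarrow> ('s, 'f, 'r) fm \<Rightarrow> ('s, 'f, 'r) fm" where
  "ren_fm \<pi> Fls = Fls"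
| "ren_fm \<pi> (Eq t u) = Eq (ren_tm \<pi> t) (ren_tm \<pi> u)"
| "ren_fm \<pi> (Rel r ts) = Rel r (map (ren_tm \<pi>) ts)"
| "ren_fm \<pi> (Neg \<phi>) = Neg (ren_fm \<pi> \<phi>)"
| "ren_fm \<pi> (And \<phi> \<chi>) = And (ren_fm \<pi> \<phi>) (ren_fm \<pi> \<chi>)"
| "ren_fm \<pi> (Ex v \<phi>) = Ex (\<pi> v) (ren_fm \<pi> \<phi>)"

definition renaming :: "('s var \<Rightarrow> 's var) \<Rightarrow> bool" where
  "renaming \<pi> \<longleftrightarrow> inj \<pi> \<and> (\<forall>v. fst (\<pi> v) = fst v)"

lemma fv_ren_tm: "fv_tm (ren_tm \<pi> t) = \<pi> ` fv_tm t"
  by (induction t) auto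

lemma fv_ren_fm: "inj \<pi> \<Longrightarrow> fv (ren_fm \<pi> \<phi>) = \<pi> ` fv \<phi>"
  by (induction \<phi>) (auto simp: fv_ren_tm inj_eq)

lemma val_ren_tm: "val M e (ren_tm \<pi> t) = val M (e \<circ> \<pi>) t"
proof (induction t)
  case (Fun f ts)
  have "map (val M e) (map (ren_tm \<pi>) ts) = map (val M (e \<circ> \<pi>)) ts"
    using Fun by (simp add: comp_def)
  then show ?case by (metis ren_tm.simps(2) val.simps(2))
qed auto

text \<open>Injectivity turns an update at \<open>\<pi> v\<close> into an update at \<open>v\<close>
  after composition with \<open>\<pi>\<close>; preservation of sorts keeps the range of the
  quantifier.\<close>

lemma sat_ren_fm: "renaming \<pi> \<Longrightarrow> sat M e (ren_fm \<pi> \<phi>) \<longleftrightarrow> sat M (e \<circ> \<pi>) \<phi>"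
proof (induction \<phi> arbitrary: e)
  case (Rel r ts)
  have "map (val M e) (map (ren_tm \<pi>) ts) = map (val M (e \<circ> \<pi>)) ts"
    by (simp add: val_ren_tm)
  then show ?case by (metis ren_fm.simps(3) sat.simps(3))
next
  case (Ex v \<phi>)
  have "e(\<pi> v := a) \<circ> \<pi> = (e \<circ> \<pi>)(v := a)" for a
    using Ex.prems by (auto simp: renaming_def inj_eq)
  then have "sat M (e(\<pi> v := a)) (ren_fm \<pi> \<phi>) \<longleftrightarrow> sat M ((e \<circ> \<pi>)(v := a)) \<phi>" for a
    using Ex.IH[OF Ex.prems] by metis
  moreover have "fst (\<pi> v) = fst v"
    using Ex.prems unfolding renaming_def by blast
  ultimately show ?case unfolding ren_fm.simps sat.simps by simp
qed (auto simp: val_ren_tm)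

lemma has_sort_ren_tm: "has_sort L t s \<Longrightarrow> renaming \<pi> \<Longrightarrow> has_sort L (ren_tm \<pi> t) s"
proof (induction rule: has_sort.induct)
  case (1 v)
  then show ?case by (metis renaming_def ren_tm.simps(1) has_sort.intros(1))
next
  case (2 f ss s ts)
  then have "list_all2 (has_sort L) (map (ren_tm \<pi>) ts) ss"
    by (auto simp: list_all2_map1 elim: list_all2_mono)
  with 2 show ?case by (auto intro: has_sort.intros)
qed

lemma wf_ren_fm: "wf_fm L \<phi> \<Longrightarrow> renaming \<pi> \<Longrightarrow> wf_fm L (ren_fm \<pi> \<phi>)"
proof (induction \<phi>)
  case (Eq t u)
  then show ?case by (auto intro: has_sort_ren_tm)
next
  case (Rel r ts)
  then show ?case by (auto simp: list_all2_map1 elim!: list_all2_mono intro: has_sort_ren_tm)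
qed auto

text \<open>Adding such a \<open>K\<close> to the index of a variable gives a variable of the same
  sort outside \<open>V\<close>; this is the source of fresh variables in what follows.\<close>

lemma finite_vars_bounded:
  fixes V :: "'s var set"
  assumes "finite V"
  obtains K where "\<And>v. v \<in> V \<Longrightarrow> snd v < K"
  using finite_nat_set_iff_bounded[THEN iffD1, of "snd ` V"] assms by auto

text \<open>Outside \<open>vs\<close> indices are raised by \<open>K\<close>, past every index in
  \<open>ws\<close>. Hence the values inside and outside \<open>vs\<close> are disjoint, and
  injectivity can be checked on each part separately.\<close>

lemma renaming_extends:
  fixes vs ws :: "'s var list"
  assumes "distinct vs" "distinct ws" "map fst vs = map fst ws"
  obtains \<pi> where "renaming \<pi>" "map \<pi> vs = ws"
proof -
  obtain K where K: "\<And>v. v \<in> set ws \<Longrightarrow> snd v < K"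
    using finite_vars_bounded[of "set ws"] by auto
  have len: "length vs = length ws"
    using assms(3) by (metis length_map)
  define \<pi> where "\<pi> v = (case map_of (zip vs ws) v of Some w \<Rightarrow> w | None \<Rightarrow> (fst v, snd v + K))" for v
  have nth: "\<pi> (vs ! i) = ws ! i" if "i < length vs" for i
    using that len assms(1) by (simp add: \<pi>_def map_of_zip_nth)
  have out: "\<pi> v = (fst v, snd v + K)" if "v \<notin> set vs" for v
    using that len by (simp add: \<pi>_def map_of_zip_is_None[symmetric] del: map_of_zip_is_None)
  have inl: "\<pi> v \<in> set ws \<and> fst (\<pi> v) = fst v" if "v \<in> set vs" for v
    using that nth len assms(3) by (metis in_set_conv_nth nth_map)
  have big: "\<not> snd (\<pi> v) < K" if "v \<notin> set vs" for v
    using out[OF that] by simp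
  have "inj \<pi>"
  proof (rule injI)
    fix u v assume eq: "\<pi> u = \<pi> v"
    show "u = v"
    proof (cases "u \<in> set vs")
      case True
      then have "v \<in> set vs" using big inl K eq by metis
      with True eq show ?thesis
        using nth len assms(2) by (metis in_set_conv_nth nth_eq_iff_index_eq)
    next
      case False
      then have "v \<notin> set vs" using big inl K eq by metis
      with False eq out show ?thesis by (simp add: prod_eq_iff)
    qed
  qed
  moreover have "fst (\<pi> v) = fst v" for v
    using inl out by (cases "v \<in> set vs") auto
  moreover have "map \<pi> vs = ws"
    using nth len by (auto intro: nth_equalityI)
  ultimately show thesis using that unfolding renaming_def by blast
qed


section \<open>Definable predicates on assignments\<close>

lemma map_map_eq_concat:
  assumes "map length as = map length vss"
  shows "map (map e) vss = as \<longleftrightarrow> map e (concat vss) = concat as"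
  using assms by (induction vss arbitrary: as) (auto simp: Cons_eq_map_conv map_concat)

text \<open>An assignment that witnesses \<open>holds\<close> agrees with \<open>e\<close> on every
  variable of the blocks, hence on all free variables.\<close>

lemma holds_map_iff:
  assumes "assignment M e" "fv \<phi> \<subseteq> set (concat vss)"
  shows "holds M \<phi> vss (map (map e) vss) \<longleftrightarrow> sat M e \<phi>"
proof
  assume "holds M \<phi> vss (map (map e) vss)"
  then obtain e' where e': "map (map e') vss = map (map e) vss" "sat M e' \<phi>"
    unfolding holds_def by auto
  have "e' v = e v" if "v \<in> fv \<phi>" for v
    using that assms(2) e'(1) by (auto simp: map_eq_conv)
  then show "sat M e \<phi>" using e'(2) sat_cong by metis
qed (use assms in \<open>auto simp: holds_def\<close>)

text \<open>Stands for a formula up to equivalence in \<open>M\<close>. Only well-sorted assignments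
  count, because quantifiers range over the domains; one formula has to serve all of them.\<close>

definition definable ::
  "('s, 'f, 'r) lang \<Rightarrow> ('s, 'f, 'r, 'u) struc \<Rightarrow> 's var set \<Rightarrow> (('s var \<Rightarrow> 'u) \<Rightarrow> bool) \<Rightarrow> bool"
where
  "definable L M V P \<longleftrightarrow>
     (\<exists>\<phi>. wf_fm L \<phi> \<and> fv \<phi> \<subseteq> V \<and> (\<forall>e. assignment M e \<longrightarrow> (sat M e \<phi> \<longleftrightarrow> P e)))"

lemma definable_mono: "definable L M V P \<Longrightarrow> V \<subseteq> V' \<Longrightarrow> definable L M V' P"
  unfolding definable_def by blast

lemma definable_congI:
  "definable L M V P \<Longrightarrow> (\<And>e. assignment M e \<Longrightarrow> P e \<longleftrightarrow> P' e) \<Longrightarrow> definable L M V P'"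
  unfolding definable_def by metis

lemma definable_depends:
  assumes "definable L M V P" "assignment M e" "assignment M e'" "\<And>v. v \<in> V \<Longrightarrow> e v = e' v"
  shows "P e \<longleftrightarrow> P e'"
  using assms sat_cong unfolding definable_def by (metis subsetD)

lemma definable_sat: "wf_fm L \<phi> \<Longrightarrow> fv \<phi> \<subseteq> V \<Longrightarrow> definable L M V (\<lambda>e. sat M e \<phi>)"
  unfolding definable_def by blast

lemma definable_False: "definable L M V (\<lambda>e. False)"
  unfolding definable_def by (rule exI[of _ Fls]) auto

lemma definable_not: "definable L M V P \<Longrightarrow> definable L M V (\<lambda>e. \<not> P e)"
  unfolding definable_def by (metis fv.simps(4) sat.simps(4) wf_fm.simps(4))

lemma definable_and:
  assumes "definable L M V P" "definable L M V Q"
  shows "definable L M V (\<lambda>e. P e \<and> Q e)"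
proof -
  obtain \<phi> \<chi> where
    "wf_fm L \<phi>" "fv \<phi> \<subseteq> V" "\<And>e. assignment M e \<Longrightarrow> sat M e \<phi> \<longleftrightarrow> P e"
    "wf_fm L \<chi>" "fv \<chi> \<subseteq> V" "\<And>e. assignment M e \<Longrightarrow> sat M e \<chi> \<longleftrightarrow> Q e"
    using assms unfolding definable_def by auto
  then show ?thesis
    unfolding definable_def by (intro exI[of _ "And \<phi> \<chi>"]) auto
qed

lemma definable_all:
  assumes "finite I" "\<And>i. i \<in> I \<Longrightarrow> definable L M V (P i)"
  shows "definable L M V (\<lambda>e. \<forall>i\<in>I. P i e)"
  using assms
proof (induction I rule: finite_induct)
  case empty
  then show ?case using definable_not[OF definable_False] by auto
next
  case (insert i I)
  then show ?case using definable_and[of L M V "P i" "\<lambda>e. \<forall>i\<in>I. P i e"] by simp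
qed

lemma definable_ex1:
  assumes "definable L M V P"
  shows "definable L M (V - {v}) (\<lambda>e. \<exists>a \<in> dom M (fst v). P (e(v := a)))"
proof -
  obtain \<phi> where \<phi>: "wf_fm L \<phi>" "fv \<phi> \<subseteq> V" "\<And>e. assignment M e \<Longrightarrow> sat M e \<phi> \<longleftrightarrow> P e"
    using assms unfolding definable_def by auto
  have "assignment M (e(v := a))" if "assignment M e" "a \<in> dom M (fst v)" for e a
    using that by (auto simp: assignment_def)
  with \<phi> show ?thesis
    unfolding definable_def by (intro exI[of _ "Ex v \<phi>"]) auto
qed

text \<open>The block \<open>W\<close> is quantified as a set: \<open>e'\<close> may differ from
  \<open>e\<close> only there. No order of \<open>W\<close> has to be fixed, and the induction peels
  off one quantifier at a time.\<close>

lemma definable_ex: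
  assumes "finite W" "definable L M V P"
  shows "definable L M (V - W) (\<lambda>e. \<exists>e'. assignment M e' \<and> (\<forall>v. v \<notin> W \<longrightarrow> e' v = e v) \<and> P e')"
  using assms(1)
proof (induction W rule: finite_induct)
  case empty
  have "(\<exists>e'. assignment M e' \<and> (\<forall>v. v \<notin> {} \<longrightarrow> e' v = e v) \<and> P e') \<longleftrightarrow> P e"
    if "assignment M e" for e :: "'a var \<Rightarrow> 'd"
  proof -
    have "(\<forall>v. v \<notin> {} \<longrightarrow> e' v = e v) \<longleftrightarrow> e' = e" for e' by auto
    then show ?thesis using that by metis
  qed
  then show ?case by (intro definable_congI[OF definable_mono[OF assms(2)]]) auto
next
  case (insert w W)
  let ?Q = "\<lambda>W e. \<exists>e'. assignment M e' \<and> (\<forall>v. v \<notin> W \<longrightarrow> e' v = e v) \<and> P e'"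
  have eq: "(\<exists>a \<in> dom M (fst w). ?Q W (e(w := a))) \<longleftrightarrow> ?Q (insert w W) e" if "assignment M e" for e
  proof
    assume "\<exists>a \<in> dom M (fst w). ?Q W (e(w := a))"
    then show "?Q (insert w W) e" by fastforce
  next
    assume "?Q (insert w W) e"
    then obtain e' where e': "assignment M e'" "\<forall>v. v \<notin> insert w W \<longrightarrow> e' v = e v" "P e'" by auto
    then have "e' w \<in> dom M (fst w)" "?Q W (e(w := e' w))"
      by (simp add: assignment_def) (use e' in \<open>auto intro!: exI[of _ e']\<close>)
    then show "\<exists>a \<in> dom M (fst w). ?Q W (e(w := a))" by blast
  qed
  have "definable L M (V - W - {w}) (?Q (insert w W))"
    by (rule definable_congI[OF definable_ex1[OF insert.IH]]) (rule eq)
  then show ?case by (rule definable_mono) auto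
qed

lemma definable_rename:
  assumes "definable L M V P" "renaming \<pi>"
  shows "definable L M (\<pi> ` V) (\<lambda>e. P (e \<circ> \<pi>))"
proof -
  obtain \<phi> where \<phi>: "wf_fm L \<phi>" "fv \<phi> \<subseteq> V" "\<And>e. assignment M e \<Longrightarrow> sat M e \<phi> \<longleftrightarrow> P e"
    using assms unfolding definable_def by auto
  have "assignment M (e \<circ> \<pi>)" if "assignment M e" for e
    using that assms(2) unfolding assignment_def renaming_def by (metis comp_apply)
  with \<phi> assms(2) show ?thesis
    unfolding definable_def
    by (intro exI[of _ "ren_fm \<pi> \<phi>"])
      (auto simp: wf_ren_fm sat_ren_fm fv_ren_fm renaming_def)
qed

text \<open>If the sorts of \<open>wss\<close> match those of \<open>vss\<close>, a renaming carries
  one to the other. Otherwise the predicate is false everywhere, as domains of distinct sorts are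
  disjoint, and \<open>Fls\<close> defines it.\<close>

lemma definable_holds:
  assumes M: "is_struc L M"
    and \<phi>: "wf_fm L \<phi>" "fv \<phi> \<subseteq> set (concat vss)" "distinct (concat vss)"
    and d: "distinct (concat wss)"
  shows "definable L M (set (concat wss)) (\<lambda>e. holds M \<phi> vss (map (map e) wss))"
proof (cases "map (map fst) vss = map (map fst) wss")
  case True
  have "map fst (concat vss) = map fst (concat wss)"
    using True by (simp add: map_concat)
  then obtain \<pi> where \<pi>: "renaming \<pi>" "map \<pi> (concat vss) = concat wss"
    using renaming_extends \<phi>(3) d by blast
  have "map length wss = map length vss"
    using arg_cong[OF True, of "map length"] by (simp add: comp_def)
  then have wss: "map (map \<pi>) vss = wss"
    using \<pi>(2) map_map_eq_concat[of wss vss \<pi>] by blast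
  have eq: "sat M (e \<circ> \<pi>) \<phi> \<longleftrightarrow> holds M \<phi> vss (map (map e) wss)" if "assignment M e" for e
  proof -
    have "assignment M (e \<circ> \<pi>)"
      using that \<pi>(1) unfolding assignment_def renaming_def by (metis comp_apply)
    moreover have "map (map e) wss = map (map (e \<circ> \<pi>)) vss"
      unfolding wss[symmetric] by simp
    ultimately show ?thesis using holds_map_iff[of M "e \<circ> \<pi>" \<phi> vss] \<phi>(2) by simp
  qed
  have "\<pi> ` set (concat vss) = set (concat wss)"
    using \<pi>(2) by (metis set_map)
  moreover have "definable L M (\<pi> ` set (concat vss)) (\<lambda>e. sat M (e \<circ> \<pi>) \<phi>)"
    by (rule definable_rename[OF definable_sat[OF \<phi>(1,2)] \<pi>(1)])
  ultimately have "definable L M (set (concat wss)) (\<lambda>e. sat M (e \<circ> \<pi>) \<phi>)"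
    by simp
  then show ?thesis by (rule definable_congI) (rule eq)
next
  case False
  have "\<not> holds M \<phi> vss (map (map e) wss)" if e: "assignment M e" for e
  proof
    assume "holds M \<phi> vss (map (map e) wss)"
    then obtain e' where e': "assignment M e'" "map (map e') vss = map (map e) wss"
      unfolding holds_def by auto
    have disj: "s = s'" if "x \<in> dom M s" "x \<in> dom M s'" for x s s'
      using M that unfolding is_struc_def by blast
    \<comment> \<open>Disjointness of the domains lets \<open>srt\<close> recover the sort of a
      variable from its value, so equal value lists have equal sort patterns.\<close>
    define srt where "srt x = (THE s. x \<in> dom M s)" for x
    have srt: "srt x = s" if "x \<in> dom M s" for x s
      unfolding srt_def using disj that by blast
    have "map (map (srt \<circ> e')) vss = map (map (srt \<circ> e)) wss"
      using arg_cong[OF e'(2), of "map (map srt)"] by simp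
    moreover have "srt \<circ> e' = fst" "srt \<circ> e = fst"
      using e e'(1) srt unfolding assignment_def comp_def by blast+
    ultimately show False using False by simp
  qed
  then show ?thesis by (intro definable_congI[OF definable_False]) auto
qed


section \<open>Definability with parameters\<close>

text \<open>Parameters are not constants of the language but values \<open>\<sigma>\<close> on a
  finite set \<open>W\<close> of variables set apart from \<open>V\<close>. In this form a parameter
  can be turned into a free variable, and back, without changing the formula.\<close>

definition pdefinable ::
  "('s, 'f, 'r) lang \<Rightarrow> ('s, 'f, 'r, 'u) struc \<Rightarrow> 'u set \<Rightarrow> 's var set \<Rightarrow>
   (('s var \<Rightarrow> 'u) \<Rightarrow> bool) \<Rightarrow> bool"
where
  "pdefinable L M A V P \<longleftrightarrow>
     (\<exists>W \<sigma> Q. finite W \<and> W \<inter> V = {} \<and> assignment M \<sigma> \<and> \<sigma> ` W \<subseteq> A \<and> definable L M (V \<union> W) Q \<and>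
        (\<forall>e. assignment M e \<longrightarrow> (P e \<longleftrightarrow> Q (override_on e \<sigma> W))))"

lemma assignment_override_on:
  "assignment M e \<Longrightarrow> assignment M \<sigma> \<Longrightarrow> assignment M (override_on e \<sigma> W)"
  by (auto simp: assignment_def override_on_def)

lemma ex_assignment: "is_struc L M \<Longrightarrow> \<exists>e. assignment M e"
  unfolding is_struc_def assignment_def
  by (intro exI[of _ "\<lambda>v. SOME a. a \<in> dom M (fst v)"]) (auto simp: some_in_eq)

lemma pdefinable_congI:
  "pdefinable L M A V P \<Longrightarrow> (\<And>e. assignment M e \<Longrightarrow> P e \<longleftrightarrow> P' e) \<Longrightarrow> pdefinable L M A V P'"
  unfolding pdefinable_def by metis

lemma pdefinable_depends:
  assumes "pdefinable L M A V P" "assignment M e" "assignment M e'" "\<And>v. v \<in> V \<Longrightarrow> e v = e' v"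
  shows "P e \<longleftrightarrow> P e'"
proof -
  obtain W \<sigma> Q where *: "W \<inter> V = {}" "assignment M \<sigma>" "definable L M (V \<union> W) Q"
    "\<And>e. assignment M e \<Longrightarrow> P e \<longleftrightarrow> Q (override_on e \<sigma> W)"
    using assms(1) unfolding pdefinable_def by blast
  have "Q (override_on e \<sigma> W) \<longleftrightarrow> Q (override_on e' \<sigma> W)"
    by (rule definable_depends[OF *(3) assignment_override_on[OF assms(2) *(2)]
          assignment_override_on[OF assms(3) *(2)]])
      (use assms(4) in \<open>auto simp: override_on_def\<close>)
  with * assms show ?thesis by simp
qed

lemma definable_imp_pdefinable:
  assumes "is_struc L M" "definable L M V P"
  shows "pdefinable L M A V P"
proof -
  obtain e where "assignment M e" using ex_assignment[OF assms(1)] ..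
  with assms(2) show ?thesis
    unfolding pdefinable_def by (intro exI[of _ "{}"] exI[of _ e] exI[of _ P]) auto
qed

text \<open>Everything outside \<open>V\<close> is shifted beyond all indices in \<open>U\<close>
  and \<open>V\<close>, in particular the parameter variables. Variables in \<open>V\<close> stay,
  so the free part is unchanged.\<close>

lemma pdefinable_fresh:
  assumes P: "pdefinable L M A V P" and "finite V" "finite U"
  obtains W \<sigma> Q where "finite W" "W \<inter> (U \<union> V) = {}" "assignment M \<sigma>" "\<sigma> ` W \<subseteq> A"
    "definable L M (V \<union> W) Q" "\<And>e. assignment M e \<Longrightarrow> P e \<longleftrightarrow> Q (override_on e \<sigma> W)"
proof -
  obtain W \<sigma> Q where *: "finite W" "W \<inter> V = {}" "assignment M \<sigma>" "\<sigma> ` W \<subseteq> A"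
    "definable L M (V \<union> W) Q" "\<And>e. assignment M e \<Longrightarrow> P e \<longleftrightarrow> Q (override_on e \<sigma> W)"
    using P unfolding pdefinable_def by blast
  obtain K where K: "\<And>v. v \<in> U \<union> V \<Longrightarrow> snd v < K"
    using finite_vars_bounded[of "U \<union> V"] assms by auto
  define \<pi> where "\<pi> v = (if v \<in> V then v else (fst v, snd v + K))" for v :: "'a var"
  have "inj \<pi>"
  proof (rule injI)
    fix u v assume "\<pi> u = \<pi> v"
    then show "u = v"
      using K[of u] K[of v] by (auto simp: \<pi>_def prod_eq_iff split: if_splits)
  qed
  then have \<pi>: "renaming \<pi>" by (auto simp: renaming_def \<pi>_def)
  \<comment> \<open>Undoes the shift. Truncated subtraction below \<open>K\<close> keeps the sort,
    so \<open>\<sigma>'\<close> is an assignment on all variables.\<close>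
  define \<sigma>' where "\<sigma>' v = \<sigma> (fst v, snd v - K)" for v
  have \<pi>W: "\<pi> w = (fst w, snd w + K)" if "w \<in> W" for w
    using that *(2) by (auto simp: \<pi>_def)
  have \<sigma>': "\<sigma>' (\<pi> w) = \<sigma> w" if "w \<in> W" for w
    using \<pi>W[OF that] by (simp add: \<sigma>'_def)
  have as: "assignment M \<sigma>'"
    using *(3) unfolding assignment_def \<sigma>'_def by (metis fst_conv)
  have fresh: "\<pi> ` W \<inter> (U \<union> V) = {}"
  proof -
    have "\<pi> w \<notin> U \<union> V" if "w \<in> W" for w
      using K[of "\<pi> w"] \<pi>W[OF that] by auto
    then show ?thesis by blast
  qed
  have PQ: "P e \<longleftrightarrow> Q (override_on e \<sigma>' (\<pi> ` W) \<circ> \<pi>)" if e: "assignment M e" for e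
  proof -
    have "Q (override_on e \<sigma> W) \<longleftrightarrow> Q (override_on e \<sigma>' (\<pi> ` W) \<circ> \<pi>)"
    proof (rule definable_depends[OF *(5)])
      show "assignment M (override_on e \<sigma> W)" using e *(3) by (rule assignment_override_on)
      have "assignment M (override_on e \<sigma>' (\<pi> ` W))" using e as by (rule assignment_override_on)
      then show "assignment M (override_on e \<sigma>' (\<pi> ` W) \<circ> \<pi>)"
        using \<pi> unfolding assignment_def renaming_def by (metis comp_apply)
      fix v assume v: "v \<in> V \<union> W"
      show "override_on e \<sigma> W v = (override_on e \<sigma>' (\<pi> ` W) \<circ> \<pi>) v"
      proof (cases "v \<in> W")
        case True
        then show ?thesis by (simp add: \<sigma>')
      next
        case False
        with v have "\<pi> v = v" "v \<notin> \<pi> ` W"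
          using fresh by (auto simp: \<pi>_def)
        with False show ?thesis by simp
      qed
    qed
    then show ?thesis using *(6)[OF e] by simp
  qed
  have "\<pi> ` (V \<union> W) = V \<union> \<pi> ` W" by (auto simp: \<pi>_def)
  then have "definable L M (V \<union> \<pi> ` W) (\<lambda>e. Q (e \<circ> \<pi>))"
    using definable_rename[OF *(5) \<pi>] by simp
  moreover have "\<sigma>' ` \<pi> ` W \<subseteq> A" using *(4) \<sigma>' by auto
  ultimately show thesis
    using that[of "\<pi> ` W" \<sigma>' "\<lambda>e. Q (e \<circ> \<pi>)"] *(1) fresh as PQ by auto
qed

text \<open>New variables in \<open>V'\<close> might collide with the parameter variables, so these
  are moved away before \<open>V\<close> is enlarged.\<close>

lemma pdefinable_mono:
  assumes "pdefinable L M A V P" "V \<subseteq> V'" "A \<subseteq> A'" "finite V'"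
  shows "pdefinable L M A' V' P"
proof -
  have "finite V" using assms(2,4) by (rule finite_subset)
  obtain W \<sigma> Q where "finite W" "W \<inter> (V' \<union> V) = {}" "assignment M \<sigma>" "\<sigma> ` W \<subseteq> A"
    "definable L M (V \<union> W) Q" "\<And>e. assignment M e \<Longrightarrow> P e \<longleftrightarrow> Q (override_on e \<sigma> W)"
    using pdefinable_fresh[OF assms(1) \<open>finite V\<close> assms(4)] by metis
  then show ?thesis
    unfolding pdefinable_def using assms(2,3)
    by (intro exI[of _ W] exI[of _ \<sigma>] exI[of _ Q]) (auto elim: definable_mono)
qed

text \<open>Once the parameter variables of \<open>P'\<close> are moved off those of
  \<open>P\<close>, a single assignment carries both sets of values.\<close>

lemma pdefinable_and:
  assumes P: "pdefinable L M A V P" and P': "pdefinable L M A V P'" and V: "finite V"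
  shows "pdefinable L M A V (\<lambda>e. P e \<and> P' e)"
proof -
  obtain W \<sigma> Q where *: "finite W" "W \<inter> V = {}" "assignment M \<sigma>" "\<sigma> ` W \<subseteq> A"
    "definable L M (V \<union> W) Q" "\<And>e. assignment M e \<Longrightarrow> P e \<longleftrightarrow> Q (override_on e \<sigma> W)"
    using P unfolding pdefinable_def by blast
  obtain W' \<sigma>' Q' where **: "finite W'" "W' \<inter> (W \<union> V) = {}" "assignment M \<sigma>'" "\<sigma>' ` W' \<subseteq> A"
    "definable L M (V \<union> W') Q'" "\<And>e. assignment M e \<Longrightarrow> P' e \<longleftrightarrow> Q' (override_on e \<sigma>' W')"
    using pdefinable_fresh[OF P' V *(1)] by metis
  let ?\<tau> = "override_on \<sigma> \<sigma>' W'"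
  have \<tau>: "assignment M ?\<tau>" using *(3) **(3) by (rule assignment_override_on)
  have def: "definable L M (V \<union> (W \<union> W')) (\<lambda>e. Q e \<and> Q' e)"
    by (intro definable_and definable_mono[OF *(5)] definable_mono[OF **(5)]) auto
  have eq: "P e \<and> P' e \<longleftrightarrow> Q (override_on e ?\<tau> (W \<union> W')) \<and> Q' (override_on e ?\<tau> (W \<union> W'))"
    if e: "assignment M e" for e
  proof -
    have "Q (override_on e ?\<tau> (W \<union> W')) \<longleftrightarrow> Q (override_on e \<sigma> W)"
      by (rule definable_depends[OF *(5) assignment_override_on[OF e \<tau>]
            assignment_override_on[OF e *(3)]])
        (use *(2) **(2) in \<open>auto simp: override_on_def\<close>)
    moreover have "Q' (override_on e ?\<tau> (W \<union> W')) \<longleftrightarrow> Q' (override_on e \<sigma>' W')"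
      by (rule definable_depends[OF **(5) assignment_override_on[OF e \<tau>]
            assignment_override_on[OF e **(3)]])
        (use *(2) **(2) in \<open>auto simp: override_on_def\<close>)
    ultimately show ?thesis using *(6)[OF e] **(6)[OF e] by simp
  qed
  have "?\<tau> ` (W \<union> W') \<subseteq> A"
    using *(4) **(4) by (auto simp: override_on_def)
  with \<tau> def eq *(1,2) **(1,2) show ?thesis
    unfolding pdefinable_def
    by (intro exI[of _ "W \<union> W'"] exI[of _ ?\<tau>] exI[of _ "\<lambda>e. Q e \<and> Q' e"]) auto
qed

lemma pdefinable_all:
  assumes "is_struc L M" "finite I" "finite V" "\<And>i. i \<in> I \<Longrightarrow> pdefinable L M A V (P i)"
  shows "pdefinable L M A V (\<lambda>e. \<forall>i\<in>I. P i e)"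
  using assms(2,4)
proof (induction I rule: finite_induct)
  case empty
  then show ?case
    using definable_imp_pdefinable[OF assms(1) definable_not[OF definable_False]] by auto
next
  case (insert i I)
  then show ?case
    using pdefinable_and[of L M A V "P i" "\<lambda>e. \<forall>i\<in>I. P i e"] assms(3) by simp
qed

text \<open>With the parameter variables moved off \<open>U\<close>, quantifying over
  \<open>U\<close> leaves them alone, and overriding by \<open>\<sigma>\<close> commutes with the
  quantifier.\<close>

lemma pdefinable_ex:
  assumes P: "pdefinable L M A V P" and "finite V" "finite U"
  shows "pdefinable L M A (V - U) (\<lambda>e. \<exists>e'. assignment M e' \<and> (\<forall>v. v \<notin> U \<longrightarrow> e' v = e v) \<and> P e')"
proof -
  obtain W \<sigma> Q where *: "finite W" "W \<inter> (U \<union> V) = {}" "assignment M \<sigma>" "\<sigma> ` W \<subseteq> A"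
    "definable L M (V \<union> W) Q" "\<And>e. assignment M e \<Longrightarrow> P e \<longleftrightarrow> Q (override_on e \<sigma> W)"
    using pdefinable_fresh[OF assms] by metis
  let ?E = "\<lambda>Q e. \<exists>e'. assignment M e' \<and> (\<forall>v. v \<notin> U \<longrightarrow> e' v = e v) \<and> Q e'"
  have "definable L M (V \<union> W - U) (?E Q)"
    using assms(3) *(5) by (rule definable_ex)
  moreover have "V \<union> W - U = V - U \<union> W" using *(2) by auto
  moreover have "?E P e \<longleftrightarrow> ?E Q (override_on e \<sigma> W)" if e: "assignment M e" for e
  proof
    assume "?E P e"
    then obtain e' where e': "assignment M e'" "\<forall>v. v \<notin> U \<longrightarrow> e' v = e v" "P e'" by auto
    then show "?E Q (override_on e \<sigma> W)"
      using *(3,6) by (intro exI[of _ "override_on e' \<sigma> W"])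
        (auto simp: assignment_override_on, simp add: override_on_def)
  next
    assume "?E Q (override_on e \<sigma> W)"
    then obtain e' where e': "assignment M e'" "\<forall>v. v \<notin> U \<longrightarrow> e' v = override_on e \<sigma> W v" "Q e'"
      by auto
    \<comment> \<open>\<open>e'\<close> takes the parameter values on \<open>W\<close>, whereas a
      witness for \<open>P\<close> must agree with \<open>e\<close> off \<open>U\<close>; so the
      values of \<open>e\<close> are put back on \<open>W\<close>.\<close>
    let ?f = "override_on e' e W"
    have f: "assignment M ?f" using e'(1) e by (rule assignment_override_on)
    have "override_on ?f \<sigma> W = e'"
      using e'(2) *(2) by (auto simp: override_on_def fun_eq_iff)
    then have "P ?f" using e'(3) *(6)[OF f] by simp
    moreover have "\<forall>v. v \<notin> U \<longrightarrow> ?f v = e v"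
      using e'(2) by (auto simp: override_on_def)
    ultimately show "?E P e" using f by blast
  qed
  ultimately show ?thesis
    unfolding pdefinable_def using *(1-4)
    by (intro exI[of _ W] exI[of _ \<sigma>] exI[of _ "?E Q"]) auto
qed

text \<open>Fixing the variables in \<open>U\<close> moves them from the free part to the parameter
  variables; \<open>Q\<close> itself is unchanged.\<close>

lemma pdefinable_plug:
  assumes P: "pdefinable L M A V P" and "finite V" "assignment M \<tau>" "U \<subseteq> V"
  shows "pdefinable L M (A \<union> \<tau> ` U) (V - U) (\<lambda>e. P (override_on e \<tau> U))"
proof -
  obtain W \<sigma> Q where *: "finite W" "W \<inter> V = {}" "assignment M \<sigma>" "\<sigma> ` W \<subseteq> A"
    "definable L M (V \<union> W) Q" "\<And>e. assignment M e \<Longrightarrow> P e \<longleftrightarrow> Q (override_on e \<sigma> W)"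
    using P unfolding pdefinable_def by blast
  have "V - U \<union> (W \<union> U) = V \<union> W" using assms(4) by auto
  then have "definable L M (V - U \<union> (W \<union> U)) Q" using *(5) by simp
  moreover have "P (override_on e \<tau> U) \<longleftrightarrow> Q (override_on e (override_on \<sigma> \<tau> U) (W \<union> U))"
    if e: "assignment M e" for e
  proof -
    have "override_on (override_on e \<tau> U) \<sigma> W = override_on e (override_on \<sigma> \<tau> U) (W \<union> U)"
      using *(2) assms(4) by (auto simp: override_on_def fun_eq_iff)
    then show ?thesis using *(6) e assms(3) by (simp add: assignment_override_on)
  qed
  moreover have "override_on \<sigma> \<tau> U ` (W \<union> U) \<subseteq> A \<union> \<tau> ` U"
    using *(4) by (auto simp: override_on_def)
  moreover have "finite U" using assms(2,4) by (rule finite_subset[rotated])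
  ultimately show ?thesis
    unfolding pdefinable_def using *(1-3) assms(3,4)
    by (intro exI[of _ "W \<union> U"] exI[of _ "override_on \<sigma> \<tau> U"] exI[of _ Q])
      (auto simp: assignment_override_on)
qed

text \<open>\<open>xs'\<close> may overlap \<open>ys\<close>, so the parameters are placed on a copy
  of \<open>ys\<close> with indices shifted beyond those of \<open>xs'\<close>.\<close>

lemma pdefinable_holds:
  assumes M: "is_struc L M" and \<phi>: "is_pfm L (\<phi>, xs, ys)"
    and \<sigma>: "assignment M \<sigma>" "set (map \<sigma> ys) \<subseteq> A" and xs': "distinct xs'"
  shows "pdefinable L M A (set xs') (\<lambda>e. holds M \<phi> [xs, ys] [map e xs', map \<sigma> ys])"
proof -
  obtain K where K: "\<And>v. v \<in> set xs' \<Longrightarrow> snd v < K"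
    using finite_vars_bounded[of "set xs'"] by auto
  define sh where "sh v = (fst v, snd v + K)" for v :: "'a var"
  define \<sigma>' where "\<sigma>' v = \<sigma> (fst v, snd v - K)" for v
  let ?ys = "map sh ys"
  have inj: "inj_on sh V" for V by (auto simp: inj_on_def sh_def prod_eq_iff)
  have disj: "set ?ys \<inter> set xs' = {}"
    using K by (auto simp: sh_def disjoint_iff) (metis not_add_less2 snd_conv)
  have d: "distinct (concat [xs', ?ys])"
    using \<phi> xs' inj disj by (auto simp: distinct_map)
  have "definable L M (set (concat [xs', ?ys])) (\<lambda>e. holds M \<phi> [xs, ys] (map (map e) [xs', ?ys]))"
    by (rule definable_holds[OF M _ _ _ d]) (use \<phi> in auto)
  moreover have as: "assignment M \<sigma>'"
    using \<sigma>(1) unfolding assignment_def \<sigma>'_def by (metis fst_conv)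
  moreover have \<sigma>': "\<sigma>' (sh v) = \<sigma> v" for v by (simp add: \<sigma>'_def sh_def)
  moreover have "map (map (override_on e \<sigma>' (set ?ys))) [xs', ?ys] = [map e xs', map \<sigma> ys]" for e
  proof -
    have "override_on e \<sigma>' (set ?ys) v = e v" if "v \<in> set xs'" for v
      using that disj by (auto simp: override_on_def)
    then show ?thesis using \<sigma>' by simp
  qed
  ultimately show ?thesis
    unfolding pdefinable_def using \<sigma>(2) disj
    by (intro exI[of _ "set ?ys"] exI[of _ \<sigma>']
        exI[of _ "\<lambda>e. holds M \<phi> [xs, ys] (map (map e) [xs', ?ys])"])
      (auto simp del: list.map(2))
qed

text \<open>The way back to syntax: an enumeration of the parameter variables becomes the block
  \<open>ys\<close>, and their values become the tuple \<open>b\<close>.\<close>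

lemma pdefinable_inst:
  assumes P: "pdefinable L M A (set xs) P" and xs: "distinct xs"
  shows "\<exists>\<phi> ys b. ((\<phi>, xs, ys), b) \<in> inst_over L A \<and>
           (\<forall>e. assignment M e \<longrightarrow> (P e \<longleftrightarrow> holds M \<phi> [xs, ys] [map e xs, b]))"
proof -
  obtain W \<sigma> Q where *: "finite W" "W \<inter> set xs = {}" "assignment M \<sigma>" "\<sigma> ` W \<subseteq> A"
    "definable L M (set xs \<union> W) Q" "\<And>e. assignment M e \<Longrightarrow> P e \<longleftrightarrow> Q (override_on e \<sigma> W)"
    using P unfolding pdefinable_def by blast
  obtain \<phi> where \<phi>: "wf_fm L \<phi>" "fv \<phi> \<subseteq> set xs \<union> W"
    "\<And>e. assignment M e \<Longrightarrow> sat M e \<phi> \<longleftrightarrow> Q e"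
    using *(5) unfolding definable_def by blast
  obtain ys where ys: "set ys = W" "distinct ys"
    using finite_distinct_list[OF *(1)] by blast
  have "P e \<longleftrightarrow> holds M \<phi> [xs, ys] [map e xs, map \<sigma> ys]" if e: "assignment M e" for e
  proof -
    let ?f = "override_on e \<sigma> W"
    have f: "assignment M ?f" using e *(3) by (rule assignment_override_on)
    have "?f v = e v" if "v \<in> set xs" for v
      using that *(2) by (auto simp: override_on_def)
    then have "[map e xs, map \<sigma> ys] = map (map ?f) [xs, ys]"
      using ys(1) by simp
    then have "holds M \<phi> [xs, ys] [map e xs, map \<sigma> ys] \<longleftrightarrow> sat M ?f \<phi>"
      using holds_map_iff[OF f, of \<phi> "[xs, ys]"] \<phi>(2) ys(1) by (metis concat.simps append_Nil2 set_append)
    then show ?thesis using \<phi>(3)[OF f] *(6)[OF e] by simp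
  qed
  moreover have "((\<phi>, xs, ys), map \<sigma> ys) \<in> inst_over L A"
    using \<phi> ys xs *(2,4) by (auto simp: inst_over_def)
  ultimately show ?thesis by blast
qed


section \<open>Saturation for types in countably many variables\<close>

lemma saturated_realises:
  assumes M: "is_struc L M" "saturated L M \<kappa>" and A: "small M \<kappa> A" and xs: "distinct xs"
    and \<Gamma>: "\<And>P. P \<in> \<Gamma> \<Longrightarrow> pdefinable L M A (set xs) P"
    and fin: "\<And>F. finite F \<Longrightarrow> F \<subseteq> \<Gamma> \<Longrightarrow> \<exists>e. assignment M e \<and> (\<forall>P\<in>F. P e)"
  shows "\<exists>e. assignment M e \<and> (\<forall>P\<in>\<Gamma>. P e)"
proof (cases "\<Gamma> = {}")
  case True
  then show ?thesis using ex_assignment[OF M(1)] by simp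
next
  case False
  have "\<forall>P\<in>\<Gamma>. \<exists>\<phi> ys b. ((\<phi>, xs, ys), b) \<in> inst_over L A \<and>
      (\<forall>e. assignment M e \<longrightarrow> (P e \<longleftrightarrow> holds M \<phi> [xs, ys] [map e xs, b]))"
    using pdefinable_inst[OF \<Gamma> xs] by blast
  then obtain \<phi> ys b where inst: "\<And>P. P \<in> \<Gamma> \<Longrightarrow> ((\<phi> P, xs, ys P), b P) \<in> inst_over L A"
    and iff: "\<And>P e. P \<in> \<Gamma> \<Longrightarrow> assignment M e \<Longrightarrow>
      P e \<longleftrightarrow> holds M (\<phi> P) [xs, ys P] [map e xs, b P]"
    by metis
  let ?I = "\<lambda>P. ((\<phi> P, xs, ys P), b P)"
  have "\<exists>a. realises M a q" if q: "finite q" "q \<subseteq> ?I ` \<Gamma>" for q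
  proof -
    obtain F where F: "F \<subseteq> \<Gamma>" "finite F" "q = ?I ` F"
      using finite_subset_image[OF q] by blast
    obtain e where e: "assignment M e" "\<forall>P\<in>F. P e"
      using fin F by blast
    have "realises M (map e xs) q"
      unfolding realises_def F(3) using iff e F(1) by auto
    then show ?thesis ..
  qed
  moreover have "?I ` \<Gamma> \<subseteq> inst_over L A" using inst by blast
  ultimately obtain a where a: "realises M a (?I ` \<Gamma>)"
    using M(2) A unfolding saturated_def by meson
  have holds: "holds M (\<phi> P) [xs, ys P] [a, b P]" if "P \<in> \<Gamma>" for P
    using a that unfolding realises_def by auto
  \<comment> \<open>\<open>\<Gamma>\<close> is nonempty, so at least one instance holds of
    \<open>a\<close>; this makes \<open>a\<close> the value of the block \<open>xs\<close> under an
    assignment.\<close>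
  obtain e where e: "assignment M e" "map e xs = a"
    using False holds unfolding holds_def by fastforce
  then have "\<forall>P\<in>\<Gamma>. P e" using holds iff by metis
  with e(1) show ?thesis by blast
qed

text \<open>Values already chosen join the parameter set in the construction below; as
  \<open>\<kappa>\<close> is infinite, finitely many of them keep it small.\<close>

lemma small_Un_finite:
  assumes "Card_order \<kappa>" "infinite (Field \<kappa>)" "small M \<kappa> A" "finite B" "B \<subseteq> univ M"
  shows "small M \<kappa> (A \<union> B)"
proof -
  have "|B| <o \<kappa>"
    using assms(1,2,4)
    by (intro finite_ordLess_infinite) (auto simp: Field_card_of intro: card_of_well_order_on card_order_on_well_order_on)
  then show ?thesis
    using card_of_Un_ordLess_infinite_Field[OF assms(2,1)] assms(3,5) by (auto simp: small_def)
qed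

text \<open>The types that \<open>saturated\<close> speaks of are in finitely many variables; the values of the
  variables \<open>v n\<close> are found one after the other, keeping the type finitely satisfiable.\<close>

lemma saturated_realises_countable:
  fixes v :: "nat \<Rightarrow> 's var"
  assumes M: "is_struc L M" "saturated L M \<kappa>" and \<kappa>: "Card_order \<kappa>" "infinite (Field \<kappa>)"
    and A: "small M \<kappa> A" and v: "inj v"
    and \<Gamma>: "\<And>P. P \<in> \<Gamma> \<Longrightarrow> \<exists>n. pdefinable L M A (v ` {..<n}) P"
    and fin: "\<And>F. finite F \<Longrightarrow> F \<subseteq> \<Gamma> \<Longrightarrow> \<exists>e. assignment M e \<and> (\<forall>P\<in>F. P e)"
  shows "\<exists>e. assignment M e \<and> (\<forall>P\<in>\<Gamma>. P e)"
proof -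
  define I where "I n e \<longleftrightarrow> assignment M e \<and> (\<forall>F. finite F \<longrightarrow> F \<subseteq> \<Gamma> \<longrightarrow>
      (\<exists>e'. assignment M e' \<and> (\<forall>i<n. e' (v i) = e (v i)) \<and> (\<forall>P\<in>F. P e')))" for n e
  have v_eq: "v i = v j \<longleftrightarrow> i = j" for i j using v by (simp add: inj_eq)
  have step: "\<exists>e2. I (Suc n) e2 \<and> (\<forall>i<n. e2 (v i) = e (v i))" if I: "I n e" for n e
  proof -
    have e: "assignment M e" using I unfolding I_def by blast
    \<comment> \<open>Depends on \<open>e0\<close> only at \<open>v n\<close>: together the
      \<open>G F\<close> form a type in one variable over \<open>A\<close> and the first
      \<open>n\<close> values, to which \<open>saturated_realises\<close> applies.\<close>
    define G where "G F e0 \<longleftrightarrow> (\<exists>e'. assignment M e' \<and> (\<forall>i<n. e' (v i) = e (v i)) \<and>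
        e' (v n) = e0 (v n) \<and> (\<forall>P\<in>F. P e'))" for F e0
    let ?A = "A \<union> e ` v ` {..<n}"
    have def: "pdefinable L M ?A (set [v n]) (G F)" if F: "finite F" "F \<subseteq> \<Gamma>" for F
    proof -
      \<comment> \<open>Finitely many predicates involve finitely many variables;
        \<open>N > n\<close> makes sure that \<open>v n\<close> is among them.\<close>
      have "\<exists>N>n. \<forall>P\<in>F. pdefinable L M A (v ` {..<N}) P"
        using F
      proof (induction F rule: finite_induct)
        case (insert P F)
        then obtain N m where "N > n" "\<forall>P\<in>F. pdefinable L M A (v ` {..<N}) P"
          "pdefinable L M A (v ` {..<m}) P"
          using \<Gamma> by (meson insert_subset)
        then show ?case
          by (intro exI[of _ "max m N"]) (auto intro: pdefinable_mono)
      qed auto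
      then obtain N where N: "N > n" "\<And>P. P \<in> F \<Longrightarrow> pdefinable L M A (v ` {..<N}) P"
        by blast
      \<comment> \<open>The variables after \<open>v n\<close> are quantified away and those before
        it are replaced by their values under \<open>e\<close>, leaving only \<open>v n\<close>
        free.\<close>
      let ?V = "v ` {..<N}" and ?U = "v ` {n<..<N}" and ?U' = "v ` {..<n}"
      let ?C = "\<lambda>e. \<forall>P\<in>F. P e"
      let ?E = "\<lambda>e0. \<exists>e'. assignment M e' \<and> (\<forall>w. w \<notin> ?U \<longrightarrow> e' w = e0 w) \<and> ?C e'"
      have C: "pdefinable L M A ?V ?C"
        using M(1) F(1) N(2) by (intro pdefinable_all) auto
      then have "pdefinable L M A (?V - ?U) ?E"
        by (rule pdefinable_ex) auto
      then have "pdefinable L M ?A (?V - ?U - ?U') (\<lambda>e0. ?E (override_on e0 e ?U'))"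
        using e N(1) by (intro pdefinable_plug) (auto simp: v_eq)
      moreover have "?V - ?U - ?U' = set [v n]"
        using N(1) by (auto simp: v_eq) (metis imageI greaterThanLessThan_iff lessThan_iff linorder_neqE_nat)
      ultimately have "pdefinable L M ?A (set [v n]) (\<lambda>e0. ?E (override_on e0 e ?U'))" by simp
      moreover have "?E (override_on e0 e ?U') \<longleftrightarrow> G F e0" if e0: "assignment M e0" for e0
      proof
        assume "?E (override_on e0 e ?U')"
        then obtain e' where e': "assignment M e'" "?C e'"
          "\<And>w. w \<notin> ?U \<Longrightarrow> e' w = override_on e0 e ?U' w"
          by blast
        have "e' (v i) = e (v i)" if "i < n" for i
        proof -
          have "v i \<notin> ?U" using that by (auto simp: v_eq)
          then show ?thesis using e'(3)[of "v i"] that by simp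
        qed
        moreover have "e' (v n) = e0 (v n)"
        proof -
          have "v n \<notin> ?U" "v n \<notin> ?U'" by (auto simp: v_eq)
          then show ?thesis using e'(3)[of "v n"] by simp
        qed
        ultimately show "G F e0" unfolding G_def using e'(1,2) by blast
      next
        assume "G F e0"
        then obtain e' where e': "assignment M e'" "\<And>i. i < n \<Longrightarrow> e' (v i) = e (v i)"
          "e' (v n) = e0 (v n)" "?C e'"
          unfolding G_def by blast
        let ?g = "override_on (override_on e0 e ?U') e' ?U"
        have g: "assignment M ?g" using e0 e e'(1) by (intro assignment_override_on)
        have "e' w = ?g w" if "w \<in> ?V" for w
        proof -
          from that obtain i where "w = v i" "i < N" by blast
          then show ?thesis
            using e'(2,3) by (cases i n rule: linorder_cases) (auto simp: override_on_def v_eq)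
        qed
        then have "?C ?g" using pdefinable_depends[OF C e'(1) g] e'(4) by blast
        with g show "?E (override_on e0 e ?U')"
          by (intro exI[of _ ?g]) (simp add: override_on_def)
      qed
      ultimately show ?thesis by (rule pdefinable_congI)
    qed
    have "\<exists>e. assignment M e \<and> (\<forall>P \<in> G ` {F. finite F \<and> F \<subseteq> \<Gamma>}. P e)"
    proof (rule saturated_realises[OF M, where A = ?A and xs = "[v n]"])
      have "e w \<in> univ M" for w
        using e unfolding assignment_def univ_def by blast
      then show "small M \<kappa> ?A" using A by (intro small_Un_finite[OF \<kappa>]) auto
      fix F' assume "finite F'" "F' \<subseteq> G ` {F. finite F \<and> F \<subseteq> \<Gamma>}"
      then obtain S where S: "S \<subseteq> {F. finite F \<and> F \<subseteq> \<Gamma>}" "finite S" "F' = G ` S"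
        by (meson finite_subset_image)
      \<comment> \<open>Finitely many conditions \<open>G F\<close> follow from the one for the
        union of the \<open>F\<close>, and the invariant \<open>I n e\<close> solves that
        union.\<close>
      then have "finite (\<Union>S)" "\<Union>S \<subseteq> \<Gamma>" by auto
      then obtain e' where "assignment M e'" "\<forall>i<n. e' (v i) = e (v i)" "\<forall>P\<in>\<Union>S. P e'"
        using I unfolding I_def by blast
      then show "\<exists>e. assignment M e \<and> (\<forall>P\<in>F'. P e)"
        unfolding S(3) G_def by (intro exI[of _ e']) blast
    qed (use def in auto)
    then obtain e0 where e0: "assignment M e0" "\<And>F. finite F \<Longrightarrow> F \<subseteq> \<Gamma> \<Longrightarrow> G F e0"
      by auto
    let ?e2 = "e(v n := e0 (v n))"
    have "assignment M ?e2" using e e0(1) by (simp add: assignment_def)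
    moreover have "\<exists>e'. assignment M e' \<and> (\<forall>i<Suc n. e' (v i) = ?e2 (v i)) \<and> (\<forall>P\<in>F. P e')"
      if F: "finite F" "F \<subseteq> \<Gamma>" for F
    proof -
      obtain e' where "assignment M e'" "\<forall>i<n. e' (v i) = e (v i)" "e' (v n) = e0 (v n)"
        "\<forall>P\<in>F. P e'"
        using e0(2)[OF F] unfolding G_def by blast
      then show ?thesis by (intro exI[of _ e']) (auto simp: v_eq less_Suc_eq)
    qed
    ultimately have "I (Suc n) ?e2" unfolding I_def by blast
    then show ?thesis by (intro exI[of _ ?e2]) (simp add: v_eq)
  qed
  obtain d where d: "assignment M d" using ex_assignment[OF M(1)] ..
  then have "I 0 d" unfolding I_def using fin by simp
  then have "\<exists>f. \<forall>n. I n (f n) \<and> (\<forall>i<n. f (Suc n) (v i) = f n (v i))"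
    using step by (intro dependent_nat_choice) auto
  then obtain f where f: "\<And>n. I n (f n)" "\<And>n i. i < n \<Longrightarrow> f (Suc n) (v i) = f n (v i)"
    by blast
  \<comment> \<open>The value at \<open>v i\<close> is final from stage \<open>Suc i\<close> on;
    outside the range of \<open>v\<close> the assignment \<open>d\<close> is a well-sorted
    default.\<close>
  define g where "g w = (if w \<in> range v then f (Suc (inv v w)) w else d w)" for w
  have "f (Suc i + k) (v i) = f (Suc i) (v i)" for i k
    by (induction k) (simp_all add: f(2))
  then have stable: "f n (v i) = f (Suc i) (v i)" if "i < n" for i n
    using that by (metis Suc_leI le_add_diff_inverse)
  have gf: "g (v i) = f n (v i)" if "i < n" for i n
    unfolding stable[OF that] using v by (simp add: g_def)
  have "assignment M (f n)" for n
    using f(1) unfolding I_def by blast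
  then have g: "assignment M g"
    using d unfolding assignment_def g_def by simp
  have "P g" if P: "P \<in> \<Gamma>" for P
  proof -
    obtain n where n: "pdefinable L M A (v ` {..<n}) P" using \<Gamma>[OF P] ..
    have "\<exists>e'. assignment M e' \<and> (\<forall>i<n. e' (v i) = f n (v i)) \<and> (\<forall>P\<in>{P}. P e')"
      using f(1)[of n] P unfolding I_def by blast
    then obtain e' where e': "assignment M e'" "\<forall>i<n. e' (v i) = f n (v i)" "P e'" by auto
    have "e' w = g w" if "w \<in> v ` {..<n}" for w
      using that e'(2) gf by auto
    then show ?thesis using pdefinable_depends[OF n e'(1) g] e'(3) by blast
  qed
  with g show ?thesis by blast
qed


section \<open>Blocks of variables\<close>

text \<open>All blocks are segments of this one enumeration, since
  \<open>saturated_realises_countable\<close> takes its variables in a single sequence. For empty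
  \<open>ss\<close> the sort is unspecified, and every block is empty.\<close>

definition seqvar :: "'s list \<Rightarrow> nat \<Rightarrow> 's var" where
  "seqvar ss n = (ss ! (n mod length ss), n)"

definition block :: "'s list \<Rightarrow> nat \<Rightarrow> 's var list" where
  "block ss i = map (\<lambda>j. seqvar ss (i * length ss + j)) [0..<length ss]"

lemma inj_seqvar: "inj (seqvar ss)"
  by (rule injI) (simp add: seqvar_def)

lemma length_block [simp]: "length (block ss i) = length ss"
  by (simp add: block_def)

lemma map_fst_block [simp]: "map fst (block ss i) = ss"
  by (rule nth_equalityI) (auto simp: block_def seqvar_def)

lemma distinct_block [simp]: "distinct (block ss i)"
  by (auto simp: block_def distinct_map inj_on_def seqvar_def)

text \<open>Dividing the index of a variable by \<open>length ss\<close> recovers the number of its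
  block.\<close>

lemma set_block_disjoint: "i \<noteq> j \<Longrightarrow> set (block ss i) \<inter> set (block ss j) = {}"
proof -
  have "snd v div length ss = i" if "v \<in> set (block ss i)" for v i
  proof -
    obtain j where "j < length ss" "snd v = i * length ss + j"
      using \<open>v \<in> set (block ss i)\<close> by (auto simp: block_def seqvar_def)
    then have "snd v div length ss = i + j div length ss"
      by (metis div_mult_self3 less_nat_zero_code)
    then show ?thesis using \<open>j < length ss\<close> by simp
  qed
  then show "i \<noteq> j \<Longrightarrow> set (block ss i) \<inter> set (block ss j) = {}" by blast
qed

lemma distinct_concat_blocks: "distinct is \<Longrightarrow> distinct (concat (map (block ss) is))"
proof (induction "is")
  case (Cons i "is")
  have "set (block ss i) \<inter> set (block ss j) = {}" if "j \<in> set is" for j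
    using that Cons.prems by (intro set_block_disjoint) auto
  then show ?case using Cons by auto
qed simp

lemma set_block_subset: "i < n \<Longrightarrow> set (block ss i) \<subseteq> seqvar ss ` {..<n * length ss}"
proof -
  assume "i < n"
  then have "Suc i * length ss \<le> n * length ss" by (intro mult_right_mono) auto
  then show ?thesis by (auto simp: block_def)
qed

lemma block_assignment:
  assumes M: "is_struc L M" and ts: "\<And>i. list_all2 (\<lambda>a s. a \<in> dom M s) (ts i) ss"
  obtains e where "assignment M e" "\<And>i. map e (block ss i) = ts i"
proof -
  obtain d where d: "assignment M d" using ex_assignment[OF M] ..
  let ?l = "length ss"
  have len: "length (ts i) = ?l" for i using ts list_all2_lengthD by blast
  have dom: "ts i ! j \<in> dom M (ss ! j)" if "j < ?l" for i j
    using ts[of i] that by (simp add: list_all2_conv_all_nth)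
  \<comment> \<open>Quotient and remainder of the index locate an entry of \<open>ts\<close>. A
    variable whose sort does not fit its position lies in no block and gets the default
    \<open>d\<close>, as do all variables when \<open>ss\<close> is empty.\<close>
  define e where "e v = (if ss \<noteq> [] \<and> fst v = ss ! (snd v mod ?l)
      then ts (snd v div ?l) ! (snd v mod ?l) else d v)" for v
  have "e v \<in> dom M (fst v)" for v
    using d dom by (auto simp: e_def assignment_def)
  then have "assignment M e" by (simp add: assignment_def)
  moreover have "map e (block ss i) = ts i" for i
    by (rule nth_equalityI) (auto simp: len block_def e_def seqvar_def)
  ultimately show thesis by (rule that)
qed

lemma assignment_sorts: "assignment M e \<Longrightarrow> list_all2 (\<lambda>a s. a \<in> dom M s) (map e xs) (map fst xs)"
  by (simp add: list_all2_conv_all_nth assignment_def)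

lemma ex_sorts: "set a \<subseteq> univ M \<Longrightarrow> \<exists>ss. list_all2 (\<lambda>a s. a \<in> dom M s) a ss"
proof (induction a)
  case (Cons x a)
  then obtain ss s where "list_all2 (\<lambda>a s. a \<in> dom M s) a ss" "x \<in> dom M s"
    by (auto simp: univ_def)
  then show ?case by (intro exI[of _ "s # ss"]) simp
qed (simp add: exI[of _ "[]"])

text \<open>The type contains \<open>Tru\<close> in a block of sorts \<open>ss\<close>, and
  \<open>holds\<close> is true only of tuples lying in the sorts of the block.\<close>

lemma realises_tp_sorts:
  assumes a: "list_all2 (\<lambda>a s. a \<in> dom M s) a ss" and M: "is_struc L M"
    and b: "realises M b (tp L M a C)"
  shows "list_all2 (\<lambda>a s. a \<in> dom M s) b ss"
proof -
  obtain e where e: "assignment M e" "map e (block ss 0) = a"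
    using block_assignment[OF M, of "\<lambda>_. a" ss] a by metis
  have "((Tru, block ss 0, []), []) \<in> tp L M a C"
    using e by (auto simp: tp_def inst_over_def Tru_def holds_def intro!: exI[of _ e])
  then obtain e' where "assignment M e'" "map e' (block ss 0) = b"
    using b unfolding realises_def holds_def by fastforce
  then show ?thesis using assignment_sorts[of M e' "block ss 0"] by simp
qed


section \<open>Transitivity\<close>

lemma pdefinable_realises:
  assumes M: "is_struc L M" and p: "finite p" "p \<subseteq> tp L M a C" and xs: "distinct xs"
  shows "pdefinable L M C (set xs) (\<lambda>e. realises M (map e xs) p)"
proof -
  have "pdefinable L M C (set xs) (\<lambda>e. case i of ((\<phi>, xs', ys), b) \<Rightarrow> holds M \<phi> [xs', ys] [map e xs, b])"
    if "i \<in> p" for i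
  proof -
    obtain \<phi> xs' ys b where i: "i = ((\<phi>, xs', ys), b)" by (metis prod_cases4 surj_pair)
    have tp: "is_pfm L (\<phi>, xs', ys)" "set b \<subseteq> C" "holds M \<phi> [xs', ys] [a, b]"
      using that p(2) unfolding i tp_def inst_over_def by auto
    \<comment> \<open>Membership in the type provides a well-sorted assignment of the parameters
      \<open>b\<close> to \<open>ys\<close>.\<close>
    then obtain \<sigma> where "assignment M \<sigma>" "map \<sigma> ys = b"
      unfolding holds_def by auto
    then show ?thesis
      unfolding i using pdefinable_holds[OF M tp(1) _ _ xs, of \<sigma> C] tp(2) by simp
  qed
  then show ?thesis
    unfolding realises_def by (intro pdefinable_all[OF M p(1)]) auto
qed

text \<open>If the conclusion fails, let \<open>Q(x; c)\<close> axiomatise \<open>p\<close> and let \<open>\<Psi>\<close> say that \<open>\<psi>\<close> holds on all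
  increasing subsequences of \<open>x\<^sub>0, \<dots>, x\<^bsub>n-1\<^esub>\<close>. Then \<open>Q(x; z)\<close> together with the inconsistency of
  \<open>Q(x\<^sub>0; z) \<and> \<dots> \<and> Q(x\<^bsub>n-1\<^esub>; z) \<and> \<Psi>\<close> is a formula \<open>\<theta>(z; x)\<close> for which \<open>\<Psi>\<close> is an inconsistency
  witness, and \<open>\<theta>(z; a)\<close> divides.\<close>

lemma indep_Xi_finitely_satisfiable:
  assumes M: "is_struc L M"
    and \<psi>: "is_kfm L ys (\<psi>, yss)"
    and ind: "indep L M (Xi L M) C D (set a)"
    and div: "divides L M (\<psi>, yss) a D"
    and a: "list_all2 (\<lambda>a s. a \<in> dom M s) a ss"
    and p: "finite p" "p \<subseteq> tp L M a C" and n: "n > 0"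
  shows "\<exists>e. assignment M e \<and> (\<forall>i<n. realises M (map e (block ss i)) p) \<and>
           (\<forall>is. sorted_wrt (<) is \<and> length is = length yss \<and> set is \<subseteq> {..<n} \<longrightarrow>
              holds M \<psi> yss (map (\<lambda>i. map e (block ss i)) is))"
proof (rule ccontr)
  assume contr: "\<not> ?thesis"
  define X where "X = block ss"
  have X: "distinct (X i)" "map fst (X i) = ss" for i by (simp_all add: X_def)
  define U where "U = (\<Union>i<n. set (X i))"
  have XU: "set (X i) \<subseteq> U" if "i < n" for i using that by (auto simp: U_def)
  have finU: "finite U" by (simp add: U_def)
  define J where "J = {is. sorted_wrt (<) is \<and> length is = length yss \<and> set is \<subseteq> {..<n}}"
  define \<Psi> where "\<Psi> e \<longleftrightarrow> (\<forall>is\<in>J. holds M \<psi> yss (map (map e) (map X is)))" for e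
  have contr': "\<not> ((\<forall>i<n. realises M (map e (X i)) p) \<and> \<Psi> e)" if "assignment M e" for e
    using contr that unfolding J_def \<Psi>_def X_def by (auto simp: comp_def)

  have "finite {is :: nat list. set is \<subseteq> {..<n} \<and> length is = length yss}"
    by (rule finite_lists_length_eq) simp
  then have finJ: "finite J" by (rule rev_finite_subset) (auto simp: J_def)
  have "definable L M U (\<lambda>e. holds M \<psi> yss (map (map e) (map X is)))" if "is \<in> J" for "is"
  proof -
    have "distinct is" using that by (simp add: J_def strict_sorted_iff)
    then have "distinct (concat (map X is))"
      unfolding X_def by (rule distinct_concat_blocks)
    then have "definable L M (set (concat (map X is))) (\<lambda>e. holds M \<psi> yss (map (map e) (map X is)))"
      using \<psi> by (intro definable_holds[OF M]) auto
    then show ?thesis by (rule definable_mono) (use that XU in \<open>auto simp: J_def\<close>)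
  qed
  then have "definable L M U \<Psi>"
    unfolding \<Psi>_def by (rule definable_all[OF finJ])
  then obtain \<psi>0 where \<psi>0: "wf_fm L \<psi>0" "fv \<psi>0 \<subseteq> U" "\<And>e. assignment M e \<Longrightarrow> sat M e \<psi>0 \<longleftrightarrow> \<Psi> e"
    unfolding definable_def by blast

  have "pdefinable L M C (set (X 0)) (\<lambda>e. realises M (map e (X 0)) p)"
    by (rule pdefinable_realises[OF M p X(1)])
  \<comment> \<open>\<open>W\<close> avoids \<open>U\<close> because the blocks in \<open>U\<close>
    get bound in \<open>\<chi>\<close>, whereas \<open>W\<close> stays free and becomes the block
    \<open>zs\<close>; the values of \<open>\<sigma>\<close> there form the tuple from
    \<open>C\<close> that violates independence.\<close>
  then obtain W \<sigma> Q where W: "finite W" "W \<inter> (U \<union> set (X 0)) = {}"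
    and \<sigma>: "assignment M \<sigma>" "\<sigma> ` W \<subseteq> C" and Q: "definable L M (set (X 0) \<union> W) Q"
    and pQ: "\<And>e. assignment M e \<Longrightarrow> realises M (map e (X 0)) p \<longleftrightarrow> Q (override_on e \<sigma> W)"
    by (rule pdefinable_fresh[OF _ finite_set finU]) (rule that)
  obtain \<phi>0 where \<phi>0: "wf_fm L \<phi>0" "fv \<phi>0 \<subseteq> set (X 0) \<union> W"
    "\<And>e. assignment M e \<Longrightarrow> sat M e \<phi>0 \<longleftrightarrow> Q e"
    using Q unfolding definable_def by blast
  obtain zs where zs: "set zs = W" "distinct zs"
    using finite_distinct_list[OF W(1)] by blast
  have disj: "set zs \<inter> set (X i) = {}" if "i < n" for i
    using W(2) zs(1) XU[OF that] by blast
  \<comment> \<open>\<open>R i\<close> is \<open>Q(x\<^sub>i; z)\<close>: block \<open>0\<close> is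
    replaced by block \<open>i\<close>, and \<open>z\<close> is no longer tied to
    \<open>\<sigma>\<close>.\<close>
  define R where "R i e \<longleftrightarrow> holds M \<phi>0 [zs, X 0] [map e zs, map e (X i)]" for i e
  have defR: "definable L M (W \<union> U) (R i)" if "i < n" for i
  proof -
    have "definable L M (set (concat [zs, X i]))
        (\<lambda>e. holds M \<phi>0 [zs, X 0] (map (map e) [zs, X i]))"
      using \<phi>0 zs X disj[OF n] disj[OF that] by (intro definable_holds[OF M]) auto
    then have "definable L M (set (concat [zs, X i])) (R i)"
      by (rule definable_congI) (simp add: R_def)
    then show ?thesis by (rule definable_mono) (use zs XU[OF that] in auto)
  qed
  have R_iff: "R i e \<longleftrightarrow> realises M (map e (X i)) p"
    if e: "assignment M e" and \<sigma>e: "\<And>w. w \<in> W \<Longrightarrow> e w = \<sigma> w" for i e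
  proof -
    \<comment> \<open>\<open>pQ\<close> speaks of block \<open>0\<close> only, so the tuple at block
      \<open>i\<close> is copied there; \<open>e'\<close> carries it on every block.\<close>
    obtain e' where e': "assignment M e'" "\<And>j. map e' (X j) = map e (X i)"
      unfolding X_def
      using block_assignment[OF M, of "\<lambda>_. map e (block ss i)" ss]
        assignment_sorts[OF e, of "block ss i"] by auto
    let ?f = "override_on e' \<sigma> W"
    have f: "assignment M ?f" using e'(1) \<sigma>(1) by (rule assignment_override_on)
    have "map ?f (X 0) = map e' (X 0)"
      using W(2) by (auto simp: override_on_def)
    moreover have "map ?f zs = map e zs"
      using \<sigma>e zs(1) by auto
    ultimately have "[map e zs, map e (X i)] = map (map ?f) [zs, X 0]"
      using e'(2)[of 0] by simp
    moreover have "fv \<phi>0 \<subseteq> set (concat [zs, X 0])" using \<phi>0(2) zs(1) by auto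
    ultimately have "R i e \<longleftrightarrow> sat M ?f \<phi>0"
      unfolding R_def using holds_map_iff[OF f] by metis
    then show ?thesis
      using \<phi>0(3)[OF f] pQ[OF e'(1)] e'(2)[of 0] by simp
  qed

  \<comment> \<open>All blocks are bound, so only \<open>z\<close> remains free. As a conjunct of
    \<open>\<theta>\<close>, this condition on \<open>z\<close> makes \<open>\<Psi>\<close> an
    inconsistency witness without parameters.\<close>
  define \<chi> where "\<chi> e \<longleftrightarrow> \<not> (\<exists>e'. assignment M e' \<and> (\<forall>v. v \<notin> U \<longrightarrow> e' v = e v) \<and>
      ((\<forall>i\<in>{..<n}. R i e') \<and> \<Psi> e'))" for e
  have "definable L M (W \<union> U) (\<lambda>e. (\<forall>i\<in>{..<n}. R i e) \<and> \<Psi> e)"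
    by (intro definable_and definable_all)
      (use defR definable_mono[OF \<open>definable L M U \<Psi>\<close>] in auto)
  then have "definable L M (W \<union> U - U) \<chi>"
    unfolding \<chi>_def by (intro definable_not definable_ex finU)
  then have "definable L M (W \<union> set (X 0)) \<chi>" by (rule definable_mono) auto
  moreover have "definable L M (W \<union> set (X 0)) Q" using Q by (simp add: Un_commute)
  ultimately have "definable L M (W \<union> set (X 0)) (\<lambda>e. Q e \<and> \<chi> e)" by (intro definable_and)
  then obtain \<theta> where \<theta>: "wf_fm L \<theta>" "fv \<theta> \<subseteq> W \<union> set (X 0)"
    "\<And>e. assignment M e \<Longrightarrow> sat M e \<theta> \<longleftrightarrow> Q e \<and> \<chi> e"
    unfolding definable_def by blast
  let ?ps = "map X [0..<n]"
  have pfm: "is_pfm L (\<theta>, zs, X 0)"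
    using \<theta> zs X(1) disj[OF n] by auto

  have "((\<theta>, zs, X 0), (\<psi>0, ?ps)) \<in> Xi L M"
  proof -
    have "set (concat ?ps) = U" by (simp add: U_def atLeast0LessThan)
    then have kfm: "is_kfm L (X 0) (\<psi>0, ?ps)"
      using \<psi>0(1,2) distinct_concat_blocks[of "[0..<n]" ss] by (simp add: copies_def X_def)
    have False
      if *: "\<And>b. b \<in> set bs \<Longrightarrow> holds M \<theta> [zs, X 0] [c, b]" "holds M \<psi>0 ?ps bs" for c bs
    proof -
      obtain e where e: "assignment M e" "map (map e) ?ps = bs" "sat M e \<psi>0"
        using *(2) unfolding holds_def by blast
      have "\<exists>f. assignment M f \<and> map f zs = c \<and> map f (X 0) = map e (X i) \<and> Q f \<and> \<chi> f"
        if "i < n" for i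
      proof -
        have "map e (X i) \<in> set bs" using that e(2) by auto
        from *(1)[OF this] show ?thesis
          unfolding holds_def using \<theta>(3) by auto
      qed
      then obtain f where f: "\<And>i. i < n \<Longrightarrow> assignment M (f i) \<and> map (f i) zs = c \<and>
          map (f i) (X 0) = map e (X i) \<and> Q (f i) \<and> \<chi> (f i)"
        by metis
      \<comment> \<open>The assignment contradicting \<open>\<chi>\<close> reads \<open>z\<close>
        from \<open>f 0\<close> and the blocks from \<open>e\<close>. All the \<open>f i\<close>
        with \<open>i < n\<close> give \<open>z\<close> the same value \<open>c\<close>, and
        \<open>n > 0\<close> makes \<open>f 0\<close> one of them.\<close>
      let ?g = "override_on (f 0) e U"
      have g: "assignment M ?g" using f[OF n] e(1) by (simp add: assignment_override_on)
      have "R i ?g" if i: "i < n" for i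
      proof -
        have "map ?g (X i) = map e (X i)" using XU[OF i] by auto
        moreover have "map ?g zs = map (f 0) zs" using W(2) zs(1) by (auto simp: override_on_def)
        ultimately have "[map ?g zs, map ?g (X i)] = map (map (f i)) [zs, X 0]"
          using f[OF n] f[OF i] by simp
        then show ?thesis
          unfolding R_def using f[OF i] \<phi>0(3) unfolding holds_def by metis
      qed
      moreover have "\<Psi> ?g"
      proof -
        have "\<Psi> e" using e(1,3) \<psi>0(3) by blast
        then show ?thesis
          using definable_depends[OF \<open>definable L M U \<Psi>\<close> g e(1)] by simp
      qed
      ultimately have "\<not> \<chi> (f 0)"
        unfolding \<chi>_def not_not using g by (intro exI[of _ ?g]) simp
      with f[OF n] show False by blast
    qed
    then have "inconsistency_witness M (\<theta>, zs, X 0) (\<psi>0, ?ps)"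
      unfolding inconsistency_witness.simps by blast
    then show ?thesis using pfm kfm unfolding Xi_def by blast
  qed

  moreover have "((\<theta>, zs, X 0), a) \<in> tp L M (map \<sigma> zs) (set a \<union> D)"
  proof -
    obtain e0 where e0: "assignment M e0" "map e0 (X 0) = a"
      using block_assignment[OF M, of "\<lambda>_. a" ss] a unfolding X_def by metis
    let ?e = "override_on e0 \<sigma> W"
    have e: "assignment M ?e" using e0(1) \<sigma>(1) by (rule assignment_override_on)
    have "realises M a p"
      using p(2) unfolding realises_def tp_def by auto
    then have "Q ?e" using pQ[OF e0(1)] e0(2) by simp
    \<comment> \<open>At the values of \<open>\<sigma>\<close>, a failure of \<open>\<chi>\<close>
      would be a sequence of the kind that \<open>contr\<close> excludes; \<open>R_iff\<close>
      translates back to realising \<open>p\<close>.\<close>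
    moreover have "\<chi> ?e"
      unfolding \<chi>_def
    proof
      assume "\<exists>e'. assignment M e' \<and> (\<forall>v. v \<notin> U \<longrightarrow> e' v = ?e v) \<and>
        ((\<forall>i\<in>{..<n}. R i e') \<and> \<Psi> e')"
      then obtain e' where e': "assignment M e'" "\<And>v. v \<notin> U \<Longrightarrow> e' v = ?e v"
        "\<And>i. i < n \<Longrightarrow> R i e'" "\<Psi> e'"
        by auto
      have "e' w = \<sigma> w" if "w \<in> W" for w
        using e'(2)[of w] that W(2) by auto
      then show False using contr'[OF e'(1)] R_iff[OF e'(1)] e'(3,4) by blast
    qed
    ultimately have "sat M ?e \<theta>" using \<theta>(3)[OF e] by blast
    moreover have "map ?e zs = map \<sigma> zs" using zs(1) by auto
    moreover have "map ?e (X 0) = a"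
      using W(2) e0(2) by (auto simp: override_on_def)
    ultimately have "holds M \<theta> [zs, X 0] [map \<sigma> zs, a]"
      unfolding holds_def using e by (intro exI[of _ ?e]) simp
    then show ?thesis using pfm by (auto simp: tp_def inst_over_def)
  qed

  \<comment> \<open>The sequence for \<open>\<psi>\<close> serves again: increasing positions in an
    increasing list of indices select an increasing list, so \<open>\<psi>\<close> on all of these
    gives \<open>\<Psi>\<close>.\<close>
  moreover have "divides L M (\<psi>0, ?ps) a D"
  proof -
    obtain bs :: "nat \<Rightarrow> 'd list" where bs: "\<forall>i. realises M (bs i) (tp L M a D)"
      "\<forall>is. sorted_wrt (<) is \<and> length is = length yss \<longrightarrow> holds M \<psi> yss (map bs is)"
      using div unfolding divides.simps by blast
    have "holds M \<psi>0 ?ps (map bs is)" if "is": "sorted_wrt (<) is" "length is = n" for "is"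
    proof -
      have "list_all2 (\<lambda>a s. a \<in> dom M s) (bs j) ss" for j
        using realises_tp_sorts[OF a M] bs(1) by blast
      then obtain e where e: "assignment M e" "\<And>i. map e (X i) = bs (is ! i)"
        unfolding X_def using block_assignment[OF M, of "\<lambda>i. bs (is ! i)" ss] by metis
      have "\<Psi> e"
        unfolding \<Psi>_def
      proof
        fix js assume js: "js \<in> J"
        then have "sorted_wrt (<) (map ((!) is) js)"
          using "is" unfolding J_def sorted_wrt_iff_nth_less
          by (auto simp: subset_iff)
        then have "holds M \<psi> yss (map bs (map ((!) is) js))"
          using bs(2) js unfolding J_def by (metis (mono_tags, lifting) length_map mem_Collect_eq)
        then show "holds M \<psi> yss (map (map e) (map X js))"
          by (simp add: comp_def e(2))
      qed
      then have "sat M e \<psi>0" using e(1) \<psi>0(3) by blast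
      moreover have "map (map e) ?ps = map bs is"
        using "is"(2) e(2) by (auto intro: nth_equalityI)
      ultimately show ?thesis unfolding holds_def using e(1) by blast
    qed
    then show ?thesis using bs(1) by (auto intro!: exI[of _ bs])
  qed

  moreover have "set (map \<sigma> zs) \<subseteq> C" using \<sigma>(2) zs(1) by auto
  ultimately show False
    using ind unfolding indep_def type_divides_def by blast
qed

lemma finite_Int_image:
  assumes "finite F"
  obtains S where "S \<subseteq> A" "finite S" "F \<inter> g ` A = g ` S"
proof -
  have "finite (F \<inter> g ` A)" "F \<inter> g ` A \<subseteq> g ` A" using assms by auto
  from finite_subset_image[OF this] show thesis using that by blast
qed

text \<open>A solution of the type made of \<open>G1\<close> and \<open>G2\<close>, read block by
  block, is the dividing sequence over \<open>C\<close>.\<close>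

lemma divides_Xi_lift:
  assumes M: "is_struc L M" "saturated L M \<kappa>" and \<kappa>: "Card_order \<kappa>" "infinite (Field \<kappa>)"
    and \<psi>: "is_kfm L ys (\<psi>, yss)"
    and C: "small M \<kappa> C" and a: "set a \<subseteq> univ M"
    and ind: "indep L M (Xi L M) C D (set a)"
    and div: "divides L M (\<psi>, yss) a D"
  shows "divides L M (\<psi>, yss) a C"
proof -
  obtain ss where ss: "list_all2 (\<lambda>a s. a \<in> dom M s) a ss" using ex_sorts[OF a] ..
  let ?X = "block ss"
  \<comment> \<open>Indexed by single instances \<open>x\<close>, so that a finite part of the type
    mentions finitely many members of \<open>tp L M a C\<close>.\<close>
  define G1 where "G1 = (\<lambda>(i, x) e. realises M (map e (?X i)) {x})"
  define G2 where "G2 is e \<longleftrightarrow> holds M \<psi> yss (map (map e) (map ?X is))" for "is" e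
  let ?J = "{is. sorted_wrt (<) is \<and> length is = length yss}"
  let ?\<Gamma> = "G1 ` (UNIV \<times> tp L M a C) \<union> G2 ` ?J"
  have "\<exists>e. assignment M e \<and> (\<forall>P\<in>?\<Gamma>. P e)"
  proof (rule saturated_realises_countable[OF M \<kappa> C inj_seqvar[of ss]])
    fix P assume "P \<in> ?\<Gamma>"
    then consider i x where "x \<in> tp L M a C" "P = G1 (i, x)" | "is" where "is \<in> ?J" "P = G2 is"
      by blast
    then show "\<exists>n. pdefinable L M C (seqvar ss ` {..<n}) P"
    proof cases
      case 1
      then have "pdefinable L M C (set (?X i)) P"
        using pdefinable_realises[OF M(1), of "{x}" a C "?X i"] by (simp add: G1_def)
      then have "pdefinable L M C (seqvar ss ` {..<Suc i * length ss}) P"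
        by (rule pdefinable_mono[OF _ set_block_subset]) auto
      then show ?thesis by blast
    next
      case 2
      obtain n where n: "\<And>i. i \<in> set is \<Longrightarrow> i < n"
        using finite_nat_set_iff_bounded[of "set is"] by auto
      have "distinct (concat (map ?X is))"
        using 2(1) by (intro distinct_concat_blocks) (simp add: strict_sorted_iff)
      then have "definable L M (set (concat (map ?X is))) P"
        unfolding 2(2) G2_def using \<psi> by (intro definable_holds[OF M(1)]) auto
      then have "definable L M (seqvar ss ` {..<n * length ss}) P"
        by (rule definable_mono) (use set_block_subset n in fastforce)
      then show ?thesis using definable_imp_pdefinable[OF M(1)] by blast
    qed
  next
    fix F assume F: "finite F" "F \<subseteq> ?\<Gamma>"
    obtain S1 where S1: "S1 \<subseteq> UNIV \<times> tp L M a C" "finite S1" "F \<inter> G1 ` (UNIV \<times> tp L M a C) = G1 ` S1"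
      by (rule finite_Int_image[OF F(1)])
    obtain S2 where S2: "S2 \<subseteq> ?J" "finite S2" "F \<inter> G2 ` ?J = G2 ` S2"
      by (rule finite_Int_image[OF F(1)])
    have "finite (fst ` S1 \<union> \<Union> (set ` S2))" using S1(2) S2(2) by auto
    then obtain n where n: "\<And>i. i \<in> fst ` S1 \<union> \<Union> (set ` S2) \<Longrightarrow> i < n"
      using finite_nat_set_iff_bounded[of "fst ` S1 \<union> \<Union> (set ` S2)"] by meson
    have "finite (snd ` S1)" "snd ` S1 \<subseteq> tp L M a C" using S1(1,2) by auto
    \<comment> \<open>All collected instances are imposed on every block up to \<open>n\<close>,
      more than \<open>F\<close> asks for. \<open>Suc n\<close> supplies the positive number of
      blocks that the new pair needs.\<close>
    from indep_Xi_finitely_satisfiable[OF M(1) \<psi> ind div ss this, of "Suc n"]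
    obtain e where e: "assignment M e"
      "\<And>i. i < Suc n \<Longrightarrow> realises M (map e (?X i)) (snd ` S1)"
      "\<And>is. sorted_wrt (<) is \<Longrightarrow> length is = length yss \<Longrightarrow> set is \<subseteq> {..<Suc n} \<Longrightarrow>
        holds M \<psi> yss (map (\<lambda>i. map e (?X i)) is)"
      by blast
    have "P e" if "P \<in> F" for P
    proof -
      have "P \<in> G1 ` (UNIV \<times> tp L M a C) \<union> G2 ` ?J" using F(2) that by (rule subsetD)
      then have "P \<in> G1 ` S1 \<union> G2 ` S2"
        unfolding S1(3)[symmetric] S2(3)[symmetric] using that by simp
      then show ?thesis
      proof (elim UnE imageE)
        fix ix assume 1: "P = G1 ix" "ix \<in> S1"
        obtain i x where ix: "ix = (i, x)" by fastforce
        have "x \<in> snd ` S1" "i < Suc n" using n[of i] 1(2) unfolding ix by force+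
        then show ?thesis using e(2)[of i] 1(1) unfolding ix by (auto simp: realises_def G1_def)
      next
        fix "is" assume 2: "P = G2 is" "is \<in> S2"
        then have "set is \<subseteq> {..<Suc n}" using n less_Suc_eq by auto
        then show ?thesis using e(3)[of "is"] 2 S2(1) by (auto simp: comp_def G2_def)
      qed
    qed
    with e(1) show "\<exists>e. assignment M e \<and> (\<forall>P\<in>F. P e)" by blast
  qed
  then obtain e where e: "assignment M e" "\<forall>P\<in>?\<Gamma>. P e" by (elim exE conjE)
  have "realises M (map e (?X i)) (tp L M a C)" for i
  proof -
    have "realises M (map e (?X i)) {x}" if "x \<in> tp L M a C" for x
      using bspec[OF e(2), of "G1 (i, x)"] that by (auto simp: G1_def)
    then show ?thesis unfolding realises_def by blast
  qed
  moreover have "holds M \<psi> yss (map (\<lambda>i. map e (?X i)) is)" if "is \<in> ?J" for "is"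
    using bspec[OF e(2), of "G2 is"] that by (auto simp: comp_def G2_def)
  ultimately show ?thesis
    by (auto intro!: exI[of _ "\<lambda>i. map e (?X i)"])
qed

text \<open>Iterated negations of \<open>Fls\<close> exist in every language. This makes
  \<open>\<kappa>\<close> infinite, since it exceeds the number of formulas.\<close>

lemma infinite_formulas: "infinite {\<phi>. wf_fm L \<phi>}"
proof -
  have "inj (\<lambda>n. (Neg ^^ n) Fls)"
  proof (rule injI)
    fix m n assume "(Neg ^^ m) Fls = (Neg ^^ n) Fls"
    then show "m = n"
    proof (induction m arbitrary: n)
      case 0
      then show ?case by (cases n) auto
    next
      case (Suc m)
      then show ?case by (cases n) auto
    qed
  qed
  moreover have "wf_fm L ((Neg ^^ n) Fls)" for n by (induction n) auto
  ultimately show ?thesis unfolding infinite_iff_countable_subset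
    by (intro exI[of _ "\<lambda>n. (Neg ^^ n) Fls"]) auto
qed

lemma transitive_Xi:
  assumes "big_model L T M \<kappa>"
  shows "transitive_pairs L M \<kappa> (Xi L M)"
proof -
  have M: "is_struc L M" "saturated L M \<kappa>" and \<kappa>: "Card_order \<kappa>" "|{\<phi>. wf_fm L \<phi>}| <o \<kappa>"
    using assms unfolding big_model_def by auto
  have "infinite (Field \<kappa>)"
  proof
    assume fin: "finite (Field \<kappa>)"
    have "|{\<phi>. wf_fm L \<phi>}| \<le>o |Field \<kappa>|"
      using \<kappa> card_of_Field_ordIso ordIso_symmetric ordLess_imp_ordLeq ordLeq_ordIso_trans by blast
    then show False using fin infinite_formulas card_of_ordLeq_finite by blast
  qed
  then show ?thesis
    unfolding transitive_pairs_def
  proof (intro allI impI, elim conjE)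
    fix \<phi> \<psi> C D a
    assume *: "(\<phi>, \<psi>) \<in> Xi L M" "small M \<kappa> C" "set a \<subseteq> univ M" "indep L M (Xi L M) C D (set a)"
      "divides L M \<psi> a D"
    obtain \<psi>' yss where \<psi>: "\<psi> = (\<psi>', yss)" by fastforce
    obtain ys where "is_kfm L ys (\<psi>', yss)" using *(1) unfolding Xi_def \<psi> by auto
    then show "divides L M \<psi> a C"
      using divides_Xi_lift[OF M \<kappa>(1) \<open>infinite (Field \<kappa>)\<close>] * unfolding \<psi> by blast
  qed
qed


section \<open>Normality\<close>

lemma fv_eq_tuple: "fv (eq_tuple us vs) \<subseteq> set us \<union> set vs"
  by (induction us vs rule: eq_tuple.induct) (auto simp: Tru_def)

lemma fv_eq_tuples: "fv (eq_tuples zss) \<subseteq> set (concat zss)"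
  by (induction zss rule: eq_tuples.induct) (use fv_eq_tuple in \<open>fastforce simp: Tru_def\<close>)+

lemma wf_eq_tuple: "map fst us = map fst vs \<Longrightarrow> wf_fm L (eq_tuple us vs)"
proof (induction us vs rule: eq_tuple.induct)
  case (1 u us v vs)
  then have "has_sort L (Var u) (fst u)" "has_sort L (Var v) (fst u)"
    using has_sort.intros(1)[of L u] has_sort.intros(1)[of L v] by auto
  with 1 show ?case by auto
qed (auto simp: Tru_def)

lemma wf_eq_tuples: "copies zss zs \<Longrightarrow> wf_fm L (eq_tuples zss)"
  by (induction zss rule: eq_tuples.induct) (auto simp: copies_def Tru_def intro!: wf_eq_tuple)

text \<open>Equal lengths matter: \<open>eq_tuple\<close> ignores the tail of the longer
  tuple.\<close>

lemma sat_eq_tuple: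
  "length us = length vs \<Longrightarrow> sat M e (eq_tuple us vs) \<longleftrightarrow> map e us = map e vs"
  by (induction us vs rule: eq_tuple.induct) (auto simp: Tru_def)

text \<open>The formula is a chain of equalities between neighbours, and \<open>copies\<close> gives
  the equal lengths that each of them requires. For empty \<open>zss\<close> any tuple is a common
  value.\<close>

lemma sat_eq_tuples:
  assumes "copies zss zs" "sat M e (eq_tuples zss)"
  shows "\<exists>c. \<forall>us\<in>set zss. map e us = c"
  using assms
proof (induction zss rule: eq_tuples.induct)
  case (1 us vs zss)
  have "copies (vs # zss) zs" using "1.prems"(1) by (simp add: copies_def)
  then obtain c where "\<forall>us\<in>set (vs # zss). map e us = c" using 1 by auto
  moreover have "length us = length vs"
    using "1.prems"(1) unfolding copies_def by (metis length_map list.set_intros)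
  ultimately show ?case using "1.prems"(2) by (simp add: sat_eq_tuple)
qed auto

text \<open>The equalities identify the \<open>z\<close>-parts, so their common value
  \<open>c\<close> can move from the parameters to the left block: \<open>(a, c)\<close> satisfies
  the original \<open>\<phi>\<close> with each \<open>y\<close>-part, against the given
  witness.\<close>

lemma normal_Xi: "normal_pairs (Xi L M)"
  unfolding normal_pairs_def
proof (intro allI impI, elim conjE)
  fix \<phi> :: "('a, 'b, 'c) fm" and xs zs ys \<psi> yss zss
  assume Xi: "((\<phi>, xs @ zs, ys), (\<psi>, yss)) \<in> Xi L M"
    and len: "length zss = length yss" and zss: "copies zss zs"
    and dist: "distinct (concat (yss @ zss))"
  have pfm: "is_pfm L (\<phi>, xs @ zs, ys)" and kfm: "is_kfm L ys (\<psi>, yss)"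
    and wit: "inconsistency_witness M (\<phi>, xs @ zs, ys) (\<psi>, yss)"
    using Xi unfolding Xi_def by auto
  let ?w = "map2 (@) zss yss"
  have set_w: "set (concat ?w) = set (concat zss) \<union> set (concat yss)"
    using len by (induction zss yss rule: list_induct2) auto
  have "distinct (concat ?w)"
    using len dist
  proof (induction zss yss rule: list_induct2)
    case (Cons z zss y yss)
    have "set (concat (map2 (@) zss yss)) = set (concat zss) \<union> set (concat yss)"
      using Cons.hyps by (induction zss yss rule: list_induct2) auto
    with Cons show ?case by auto
  qed simp
  moreover have "copies ?w (zs @ ys)"
    using zss kfm len by (auto simp: copies_def set_zip)
  moreover have "fv (And \<psi> (eq_tuples zss)) \<subseteq> set (concat ?w)"
    using kfm fv_eq_tuples[of zss] set_w by auto
  ultimately have kfm': "is_kfm L (zs @ ys) (And \<psi> (eq_tuples zss), ?w)"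
    using kfm wf_eq_tuples[OF zss] by simp
  have pfm': "is_pfm L (\<phi>, xs, zs @ ys)" using pfm by auto
  have False
    if *: "\<And>b. b \<in> set bs \<Longrightarrow> holds M \<phi> [xs, zs @ ys] [a, b]"
      "holds M (And \<psi> (eq_tuples zss)) ?w bs" for a bs
  proof -
    obtain e where e: "assignment M e" "map (map e) ?w = bs" "sat M e \<psi>" "sat M e (eq_tuples zss)"
      using *(2) unfolding holds_def by auto
    obtain c where c: "\<And>us. us \<in> set zss \<Longrightarrow> map e us = c"
      using sat_eq_tuples[OF zss e(4)] by blast
    have "holds M \<phi> [xs @ zs, ys] [a @ c, b]" if b: "b \<in> set (map (map e) yss)" for b
    proof -
      obtain i where i: "i < length yss" "b = map e (yss ! i)"
        using b by (auto simp: in_set_conv_nth)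
      have zi: "zss ! i \<in> set zss" using i(1) len by simp
      have "?w ! i \<in> set ?w" by (rule nth_mem) (use i(1) len in simp)
      have "c @ b = map e (?w ! i)" using i len c[OF zi] by simp
      also have "\<dots> \<in> set bs"
        unfolding e(2)[symmetric] using \<open>?w ! i \<in> set ?w\<close> by (subst set_map) (rule imageI)
      finally have "holds M \<phi> [xs, zs @ ys] [a, c @ b]" by (rule *(1))
      then obtain f where f: "assignment M f" "map f xs = a" "map f zs @ map f ys = c @ b" "sat M f \<phi>"
        unfolding holds_def by auto
      \<comment> \<open>Comparing lengths splits the concatenated parameter tuple at the boundary
        between \<open>zs\<close> and \<open>ys\<close>.\<close>
      have "length (zss ! i) = length zs"
        using zss zi unfolding copies_def by (metis length_map)
      then have "length c = length zs" using c[OF zi] by auto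
      then have "map f zs = c" "map f ys = b" using f(3) by auto
      then show ?thesis unfolding holds_def using f(1,2,4) by auto
    qed
    moreover have "holds M \<psi> yss (map (map e) yss)"
      unfolding holds_def using e(1,3) by blast
    ultimately show False using wit unfolding inconsistency_witness.simps by blast
  qed
  then have "inconsistency_witness M (\<phi>, xs, zs @ ys) (And \<psi> (eq_tuples zss), ?w)"
    unfolding inconsistency_witness.simps by blast
  then show "((\<phi>, xs, zs @ ys), (And \<psi> (eq_tuples zss), ?w)) \<in> Xi L M"
    using pfm' kfm' unfolding Xi_def by blast
qed

theorem mainTheorem8:
  fixes L :: "('s, 'f, 'r) lang"
    and T :: "('s, 'f, 'r) fm set"
    and M :: "('s, 'f, 'r, 'u) struc"
    and \<kappa> :: "'k rel"
  assumes "\<forall>\<sigma>\<in>T. sentence L \<sigma>"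
    and "consistent L T"
    and "complete L T"
    and "big_model L T M \<kappa>"
  shows "transitive_pairs L M \<kappa> (Xi L M) \<and> normal_pairs (Xi L M)"
  using transitive_Xi[OF assms(4)] normal_Xi by blast

end
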